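(* If the Bessis-Moussa-Villani conjecture is true for some positive integer $m_0$, then it is also true for all positive integers $m < m_0$.
   Context: Matrices are complex. A positive semidefinite matrix is a complex Hermitian matrix all of whose eigenvalues are nonnegative. For a positive integer $m$, "the Bessis-Moussa-Villani conjecture is true for $m$" means: for every positive integer $n$ and all $n\times n$ positive semidefinite matrices $A$ and $B$, the polynomial $p(t) = \mathrm{Tr}[(A+tB)^m]$ in $t$ (which has real coefficients) has all nonnegative coefficients. *)

theory Defs
  imports
    "HOL-Library.Nonpos_Ints"
    "HOL-Computational_Algebra.Polynomial"
    "Jordan_Normal_Form.Char_Poly"
    "Jordan_Normal_Form.Schur_Decomposition"
begin

definition mat_trace :: "'a :: comm_monoid_add mat \<Rightarrow> 'a"
  where "mat_trace A = (\<Sum>i<dim_row A. A $$ (i, i))"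

definition hermitian_mat :: "nat \<Rightarrow> complex mat \<Rightarrow> bool"
  where "hermitian_mat n A \<longleftrightarrow> A \<in> carrier_mat n n \<and> mat_adjoint A = A"

definition psd_mat :: "nat \<Rightarrow> complex mat \<Rightarrow> bool"
  where "psd_mat n A \<longleftrightarrow>
    hermitian_mat n A \<and> (\<forall>k. eigenvalue A k \<longrightarrow> k \<in> \<real>\<^sub>\<ge>\<^sub>0)"

text \<open>The polynomial \<open>Tr ((A + t B) ^ m)\<close> in \<open>t\<close>: the power and the trace are taken of a
  matrix over the ring of complex polynomials, with \<open>t\<close> the indeterminate \<open>[:0, 1:]\<close>.\<close>

definition bmv_poly :: "nat \<Rightarrow> complex mat \<Rightarrow> complex mat \<Rightarrow> complex poly"
  where "bmv_poly m A B =
    mat_trace ((map_mat (\<lambda>a. [:a:]) A + [:0, 1:] \<cdot>\<^sub>m map_mat (\<lambda>b. [:b:]) B) ^\<^sub>m m)"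

text \<open>Membership in \<open>\<real>\<^sub>\<ge>\<^sub>0\<close> says that a complex coefficient is real and nonnegative.\<close>

definition BMV :: "nat \<Rightarrow> bool"
  where "BMV m \<longleftrightarrow>
    (\<forall>n A B. 0 < n \<longrightarrow> psd_mat n A \<longrightarrow> psd_mat n B \<longrightarrow>
      (\<forall>k. coeff (bmv_poly m A B) k \<in> \<real>\<^sub>\<ge>\<^sub>0))"

end

theory Submission
  imports "HOL-Analysis.Function_Topology" "HOL-Analysis.Topology_Euclidean_Space" Defs
begin

text \<open>
  It suffices to pass from exponent \<open>m + 1\<close> to exponent \<open>m > 0\<close>, which is done by contradiction with
  a variational argument due to Hillar. Let \<open>S\<^sub>m\<^sub>,\<^sub>k(A, B)\<close> be the sum of all words of
  length \<open>m\<close> in \<open>A\<close> and \<open>B\<close> containing \<open>k\<close> letters \<open>B\<close>, that is, the coefficient of \<open>t ^ k\<close> in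
  \<open>(A + t B) ^ m\<close>; the coefficients of the polynomial in question are the traces
  \<open>f(A, B) = Tr S\<^sub>m\<^sub>,\<^sub>k(A, B)\<close>. They are real because reversing words shows that \<open>S\<^sub>m\<^sub>,\<^sub>k(A, B)\<close> is
  Hermitian. Suppose that one of them is negative for some positive semidefinite pair.

  Since \<open>f\<close> is homogeneous of degree \<open>l = m - k\<close> in \<open>A\<close> and \<open>k\<close> in \<open>B\<close>, it may be studied on the
  compact set of pairs of trace one, where it has a minimum \<open>c < 0\<close> at some \<open>(A, B)\<close>. By homogeneity,
  \<open>f(A', B') \<ge> c (Tr A') ^ l (Tr B') ^ k\<close> for all positive semidefinite pairs, with equality
  at \<open>(A, B)\<close>. The matrices \<open>(1 + e X) A (1 + e X)\<^sup>*\<close> remain positive semidefinite for all real \<open>e\<close> and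
  every \<open>X\<close>, so the derivative of the difference of the two sides along such a curve vanishes
  at \<open>e = 0\<close>. Because the derivative of \<open>Tr M ^ m\<close> in direction \<open>N\<close> is \<open>m Tr (M ^ (m - 1) N)\<close>, the choice
  \<open>X = U A\<close> with \<open>U = m S\<^sub>m\<^sub>-\<^sub>1\<^sub>,\<^sub>k - c l\<close>, together with the analogous choice \<open>Y = V B\<close> with
  \<open>V = m S\<^sub>m\<^sub>-\<^sub>1\<^sub>,\<^sub>k\<^sub>-\<^sub>1 - c k\<close> for the second matrix, turns this derivative into
  \<open>2 Tr X X\<^sup>* + 2 Tr Y Y\<^sup>*\<close>. Hence \<open>U A = 0\<close> and \<open>V B = 0\<close> (lemma \<open>stationary\<close>), and adding the two
  equations gives \<open>m S\<^sub>m\<^sub>,\<^sub>k(A, B) = c C\<close> with \<open>C = l A + k B\<close> (lemma \<open>word_sum_at_minimum\<close>).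

  Finally, by Euler's identities \<open>Tr (S\<^sub>m\<^sub>,\<^sub>k A)\<close> and \<open>Tr (S\<^sub>m\<^sub>,\<^sub>k B)\<close> are nonnegative multiples of
  coefficients for the exponent \<open>m + 1\<close>, hence nonnegative. As \<open>c < 0\<close>, this means \<open>Tr (C A) \<le> 0\<close>
  and \<open>Tr (C B) \<le> 0\<close>, so \<open>Tr (C C) = l Tr (C A) + k Tr (C B) \<le> 0\<close>, and the Hermitian matrix \<open>C\<close>
  is zero. But \<open>Tr C = l + k = m > 0\<close>.

  Positive semidefiniteness enters through quadratic forms rather than eigenvalues: this description
  is visibly closed and stable under congruence. That nonnegative eigenvalues imply a nonnegative
  form is obtained by minimizing the Rayleigh quotient.
\<close>

section \<open>Square complex matrices, adjoints and traces\<close>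

text \<open>The simplifier cannot guess the inner dimension of a product; for square matrices it need not.\<close>

lemma square_mult_carrier [simp]:
  "A \<in> carrier_mat n n \<Longrightarrow> B \<in> carrier_mat n n \<Longrightarrow> A * B \<in> carrier_mat n n"
  by (rule mult_carrier_mat)

lemma mult_entry:
  assumes "A \<in> carrier_mat n n" "B \<in> carrier_mat n n" "i < n" "j < n"
  shows "(A * B) $$ (i, j) = (\<Sum>l<n. A $$ (i, l) * B $$ (l, j))"
  using assms by (auto simp: scalar_prod_def atLeast0LessThan)

lemma square_distrib:
  fixes A B C :: "'a :: comm_ring_1 mat"
  assumes "A \<in> carrier_mat n n" "B \<in> carrier_mat n n" "C \<in> carrier_mat n n"
  shows "(A + B) * C = A * C + B * C" "A * (B + C) = A * B + A * C"
  using assms by (simp_all add: add_mult_distrib_mat[of A n n B C n] mult_add_distrib_mat[of A n n B n C])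

lemma square_smult:
  fixes A B :: "'a :: comm_ring_1 mat"
  assumes "A \<in> carrier_mat n n" "B \<in> carrier_mat n n"
  shows "(c \<cdot>\<^sub>m A) * B = c \<cdot>\<^sub>m (A * B)" "A * (c \<cdot>\<^sub>m B) = c \<cdot>\<^sub>m (A * B)"
  using assms by (simp_all add: mult_smult_assoc_mat[of A n n B n] mult_smult_distrib[of A n n B n])

lemma smult_smult_mat: "a \<cdot>\<^sub>m (b \<cdot>\<^sub>m A) = (a * b) \<cdot>\<^sub>m (A :: 'a :: semigroup_mult mat)"
  by (rule eq_matI) (auto simp: mult.assoc)

lemma adjoint_carrier [simp]: "A \<in> carrier_mat n n \<Longrightarrow> mat_adjoint A \<in> carrier_mat n n"
  by (auto simp: mat_adjoint_def)

lemma adjoint_dim [simp]: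
  "dim_row (mat_adjoint A) = dim_col A" "dim_col (mat_adjoint A) = dim_row A"
  by (auto simp: mat_adjoint_def)

lemma adjoint_entry:
  fixes A :: "complex mat"
  assumes "A \<in> carrier_mat n n" "i < n" "j < n"
  shows "mat_adjoint A $$ (i, j) = cnj (A $$ (j, i))"
  using assms by (auto simp: mat_adjoint_def mat_of_rows_def conjugate_complex_def)

lemma adjoint_mult:
  fixes A B :: "complex mat"
  assumes A: "A \<in> carrier_mat n n" and B: "B \<in> carrier_mat n n"
  shows "mat_adjoint (A * B) = mat_adjoint B * mat_adjoint A"
proof (rule eq_matI)
  show "dim_row (mat_adjoint (A * B)) = dim_row (mat_adjoint B * mat_adjoint A)"
    "dim_col (mat_adjoint (A * B)) = dim_col (mat_adjoint B * mat_adjoint A)"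
    using adjoint_carrier[OF mult_carrier_mat[OF A B]] mult_carrier_mat[OF adjoint_carrier[OF B] adjoint_carrier[OF A]]
    by (simp_all only: carrier_matD)
  fix i j assume "i < dim_row (mat_adjoint B * mat_adjoint A)" "j < dim_col (mat_adjoint B * mat_adjoint A)"
  then have ij: "i < n" "j < n"
    using adjoint_carrier[OF A] adjoint_carrier[OF B] by auto
  have "mat_adjoint (A * B) $$ (i, j) = cnj (\<Sum>l<n. A $$ (j, l) * B $$ (l, i))"
    using ij by (simp only: adjoint_entry[OF mult_carrier_mat[OF A B]] mult_entry[OF A B])
  also have "\<dots> = (\<Sum>l<n. mat_adjoint B $$ (i, l) * mat_adjoint A $$ (l, j))"
    unfolding cnj_sum using ij by (intro sum.cong) (simp_all add: adjoint_entry[OF A] adjoint_entry[OF B])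
  also have "\<dots> = (mat_adjoint B * mat_adjoint A) $$ (i, j)"
    using ij by (simp only: mult_entry[OF adjoint_carrier[OF B] adjoint_carrier[OF A]])
  finally show "mat_adjoint (A * B) $$ (i, j) = (mat_adjoint B * mat_adjoint A) $$ (i, j)" .
qed

lemma adjoint_add:
  fixes A B :: "complex mat"
  shows "A \<in> carrier_mat n n \<Longrightarrow> B \<in> carrier_mat n n \<Longrightarrow> mat_adjoint (A + B) = mat_adjoint A + mat_adjoint B"
  by (auto simp: adjoint_entry[where n = n] intro!: eq_matI)

lemma trace_eq_sum: "A \<in> carrier_mat n n \<Longrightarrow> mat_trace A = (\<Sum>i<n. A $$ (i, i))"
  by (auto simp: mat_trace_def)

lemma trace_add:
  "A \<in> carrier_mat n n \<Longrightarrow> B \<in> carrier_mat n n \<Longrightarrow> mat_trace (A + B) = mat_trace A + mat_trace B"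
  by (simp add: trace_eq_sum[where n = n] sum.distrib)

lemma trace_smult:
  "A \<in> carrier_mat n n \<Longrightarrow> mat_trace (c \<cdot>\<^sub>m A) = c * mat_trace (A :: 'a :: comm_semiring_1 mat)"
  by (simp add: trace_eq_sum[where n = n] sum_distrib_left)

lemma trace_mult_entries:
  "A \<in> carrier_mat n n \<Longrightarrow> B \<in> carrier_mat n n \<Longrightarrow>
    mat_trace (A * B) = (\<Sum>i<n. \<Sum>j<n. A $$ (i, j) * B $$ (j, i))"
  by (simp add: trace_eq_sum[where n = n] mult_entry[where n = n] del: index_mult_mat)

lemma trace_mult_commute:
  fixes A :: "'a :: comm_semiring_1 mat"
  assumes "A \<in> carrier_mat n n" "B \<in> carrier_mat n n"
  shows "mat_trace (A * B) = mat_trace (B * A)"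
  unfolding trace_mult_entries[OF assms] trace_mult_entries[OF assms(2,1)]
  by (subst sum.swap) (simp add: mult.commute)

lemma trace_mult_adjoint:
  assumes A: "A \<in> carrier_mat n n"
  shows "mat_trace (A * mat_adjoint A) = of_real (\<Sum>i<n. \<Sum>j<n. (cmod (A $$ (i, j)))\<^sup>2)"
  using A by (simp add: trace_mult_entries[where n = n] adjoint_entry[where n = n] complex_norm_square[symmetric] del: of_real_power)

lemma trace_mult_adjoint_nonneg:
  assumes A: "A \<in> carrier_mat n n"
  shows "0 \<le> Re (mat_trace (A * mat_adjoint A))"
  by (simp add: trace_mult_adjoint[OF A] sum_nonneg)

lemma zero_if_trace_mult_adjoint_le_zero:
  assumes A: "A \<in> carrier_mat n n" and "Re (mat_trace (A * mat_adjoint A)) \<le> 0"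
  shows "A = 0\<^sub>m n n"
proof (rule eq_matI)
  have "(\<Sum>i<n. \<Sum>j<n. (cmod (A $$ (i, j)))\<^sup>2) = 0"
    using assms(2) by (intro antisym sum_nonneg) (auto simp: trace_mult_adjoint[OF A])
  then show "A $$ (i, j) = 0\<^sub>m n n $$ (i, j)" if "i < dim_row (0\<^sub>m n n)" "j < dim_col (0\<^sub>m n n)" for i j
    using that by (auto simp: sum_nonneg_eq_0_iff sum_nonneg)
qed (use A in auto)

lemma hermitian_carrier: "hermitian_mat n A \<Longrightarrow> A \<in> carrier_mat n n"
  by (simp add: hermitian_mat_def)

lemma hermitian_entry:
  "hermitian_mat n A \<Longrightarrow> i < n \<Longrightarrow> j < n \<Longrightarrow> cnj (A $$ (i, j)) = A $$ (j, i)"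
  by (metis adjoint_entry hermitian_mat_def)

lemma hermitianI:
  assumes "A \<in> carrier_mat n n" "\<And>i j. i < n \<Longrightarrow> j < n \<Longrightarrow> cnj (A $$ (i, j)) = A $$ (j, i)"
  shows "hermitian_mat n A"
  unfolding hermitian_mat_def using assms by (auto simp: adjoint_entry[where n = n] intro!: eq_matI)

lemma hermitian_add:
  "hermitian_mat n A \<Longrightarrow> hermitian_mat n B \<Longrightarrow> hermitian_mat n (A + B)"
  by (frule hermitian_carrier, frule hermitian_carrier[of n B]) (rule hermitianI, auto simp: hermitian_entry)

lemma hermitian_smult:
  "hermitian_mat n A \<Longrightarrow> hermitian_mat n (complex_of_real c \<cdot>\<^sub>m A)"
  by (frule hermitian_carrier) (rule hermitianI, auto simp: hermitian_entry)

lemma hermitian_one: "hermitian_mat n (1\<^sub>m n)"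
  by (rule hermitianI) auto

lemma hermitian_trace_real:
  assumes "hermitian_mat n A"
  shows "mat_trace A = of_real (Re (mat_trace A))"
proof -
  have "cnj (mat_trace A) = mat_trace A"
    using assms by (simp add: trace_eq_sum[OF hermitian_carrier] hermitian_entry)
  then show ?thesis
    by (metis Reals_cnj_iff of_real_Re)
qed

section \<open>Quadratic forms\<close>

text \<open>Vectors are functions on all indices, of which only the first \<open>n\<close> entries matter. This way
  they live in a topological space that does not depend on \<open>n\<close>.\<close>

definition mat_app :: "nat \<Rightarrow> complex mat \<Rightarrow> (nat \<Rightarrow> complex) \<Rightarrow> nat \<Rightarrow> complex"
  where "mat_app n A z = (\<lambda>i. \<Sum>j<n. A $$ (i, j) * z j)"

definition quad_form :: "nat \<Rightarrow> complex mat \<Rightarrow> (nat \<Rightarrow> complex) \<Rightarrow> complex"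
  where "quad_form n A z = (\<Sum>i<n. cnj (z i) * mat_app n A z i)"

definition form_nonneg :: "nat \<Rightarrow> complex mat \<Rightarrow> bool"
  where "form_nonneg n A \<longleftrightarrow> hermitian_mat n A \<and> (\<forall>z. 0 \<le> Re (quad_form n A z))"

lemma form_nonneg_carrier: "form_nonneg n A \<Longrightarrow> A \<in> carrier_mat n n"
  by (simp add: form_nonneg_def hermitian_carrier)

lemma mat_app_mult:
  assumes "A \<in> carrier_mat n n" "B \<in> carrier_mat n n" "i < n"
  shows "mat_app n (A * B) z i = mat_app n A (mat_app n B z) i"
  using assms
  by (simp add: mat_app_def mult_entry[where n = n] sum_distrib_left sum_distrib_right mult.assoc
      del: index_mult_mat) (rule sum.swap)

lemma inner_mat_app_adjoint:
  assumes "A \<in> carrier_mat n n"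
  shows "(\<Sum>i<n. cnj (z i) * mat_app n A w i) = (\<Sum>i<n. cnj (mat_app n (mat_adjoint A) z i) * w i)"
proof -
  have "(\<Sum>i<n. cnj (z i) * mat_app n A w i) = (\<Sum>i<n. \<Sum>j<n. cnj (z i) * (A $$ (i, j) * w j))"
    by (simp add: mat_app_def sum_distrib_left)
  also have "\<dots> = (\<Sum>j<n. \<Sum>i<n. cnj (z i) * (A $$ (i, j) * w j))"
    by (rule sum.swap)
  also have "\<dots> = (\<Sum>j<n. cnj (mat_app n (mat_adjoint A) z j) * w j)"
    using assms by (simp add: mat_app_def sum_distrib_right sum_distrib_left
        adjoint_entry[where n = n] mult_ac)
  finally show ?thesis .
qed

lemma quad_form_congruence:
  assumes T: "T \<in> carrier_mat n n" and A: "A \<in> carrier_mat n n"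
  shows "quad_form n (T * A * mat_adjoint T) z = quad_form n A (mat_app n (mat_adjoint T) z)"
proof -
  have "quad_form n (T * A * mat_adjoint T) z = 
      (\<Sum>i<n. cnj (z i) * mat_app n (T * A) (mat_app n (mat_adjoint T) z) i)"
    using T A by (simp add: quad_form_def mat_app_mult[where n = n])
  also have "\<dots> = (\<Sum>i<n. cnj (z i) * mat_app n T (mat_app n A (mat_app n (mat_adjoint T) z)) i)"
    using T A by (simp add: mat_app_mult[where n = n])
  also have "\<dots> = quad_form n A (mat_app n (mat_adjoint T) z)"
    unfolding quad_form_def by (rule inner_mat_app_adjoint[OF T])
  finally show ?thesis .
qed

lemma form_nonneg_congruence:
  assumes T: "T \<in> carrier_mat n n" and A: "form_nonneg n A"
  shows "form_nonneg n (T * A * mat_adjoint T)"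
proof -
  have Ac: "A \<in> carrier_mat n n" "mat_adjoint A = A"
    using A by (auto simp: form_nonneg_def hermitian_mat_def)
  have TT: "mat_adjoint (mat_adjoint T) = T"
    by (rule eq_matI) (use T adjoint_carrier[OF T] adjoint_carrier[OF adjoint_carrier[OF T]] in
      \<open>auto simp: adjoint_entry[where n = n]\<close>)
  have "mat_adjoint (T * A * mat_adjoint T) = T * (A * mat_adjoint T)"
    using T Ac by (simp add: adjoint_mult[where n = n] TT)
  also have "\<dots> = T * A * mat_adjoint T"
    using T Ac by (simp add: assoc_mult_mat[where n\<^sub>1 = n and n\<^sub>2 = n and n\<^sub>3 = n and n\<^sub>4 = n])
  finally show ?thesis
    using A T Ac unfolding form_nonneg_def hermitian_mat_def
    by (auto simp: quad_form_congruence)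
qed

lemma inner_hermitian:
  assumes "hermitian_mat n A"
  shows "(\<Sum>i<n. cnj (z i) * mat_app n A w i) = cnj (\<Sum>i<n. cnj (w i) * mat_app n A z i)"
  using inner_mat_app_adjoint[of A n z w] assms
  by (simp add: hermitian_mat_def mult.commute)

text \<open>The restriction of a Hermitian form to a real line is a quadratic polynomial, whose
  linear coefficient involves only the image of the base point.\<close>

lemma quad_form_add:
  assumes "hermitian_mat n A"
  shows "Re (quad_form n A (\<lambda>i. x i + of_real e * u i)) =
    Re (quad_form n A x) + 2 * e * Re (\<Sum>i<n. cnj (u i) * mat_app n A x i)
      + e\<^sup>2 * Re (quad_form n A u)"
proof -
  have app: "mat_app n A (\<lambda>i. x i + of_real e * u i) i = mat_app n A x i + of_real e * mat_app n A u i" for i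
    by (simp add: mat_app_def algebra_simps sum.distrib sum_distrib_left)
  let ?I = "\<lambda>z w. \<Sum>i<n. cnj (z i) * mat_app n A w i"
  have "quad_form n A (\<lambda>i. x i + of_real e * u i)
      = ?I x x + of_real e * ?I u x + of_real e * ?I x u + of_real (e\<^sup>2) * ?I u u"
    by (simp add: quad_form_def app algebra_simps sum.distrib sum_distrib_left power2_eq_square)
  moreover have "Re (?I x u) = Re (?I u x)"
    by (subst inner_hermitian[OF assms]) simp
  ultimately show ?thesis
    by (simp add: quad_form_def)
qed

lemma nonneg_quadratic_linear_coeff_zero:
  fixes b c :: real
  assumes "\<And>e. 0 \<le> 2 * e * b + e\<^sup>2 * c"
  shows "b = 0"
proof (rule ccontr)
  assume b: "b \<noteq> 0"
  \<comment> \<open>At \<open>e = - b / d\<close> with \<open>d > c\<close> the linear term dominates.\<close>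
  define d where "d = \<bar>c\<bar> + 1"
  have d: "d > 0" "c < d" by (auto simp: d_def)
  have "0 \<le> 2 * (- b / d) * b + (- b / d)\<^sup>2 * c"
    by (rule assms)
  also have "\<dots> = (b\<^sup>2 / d) * (c / d - 2)"
    using d by (simp add: power2_eq_square field_simps)
  also have "\<dots> < 0"
    using b d by (intro mult_pos_neg) (auto simp: field_simps)
  finally show False by simp
qed

text \<open>The nonnegative polynomial \<open>e \<mapsto> q(x + e A x)\<close> vanishes at \<open>0\<close>; hence so does its linear
  coefficient \<open>2 |A x|\<^sup>2\<close>.\<close>

lemma mat_app_zero_if_quad_form_zero:
  assumes "form_nonneg n A" "Re (quad_form n A x) = 0" "i < n"
  shows "mat_app n A x i = 0"
proof -
  define u where "u = mat_app n A x"
  have "0 \<le> 2 * e * Re (\<Sum>i<n. cnj (u i) * u i) + e\<^sup>2 * Re (quad_form n A u)" for e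
  proof -
    have "0 \<le> Re (quad_form n A (\<lambda>i. x i + of_real e * u i))"
      using assms(1) by (simp add: form_nonneg_def)
    then show ?thesis
      using assms(1,2) by (subst (asm) quad_form_add) (simp_all add: form_nonneg_def u_def)
  qed
  then have "Re (\<Sum>i<n. cnj (u i) * u i) = 0"
    by (rule nonneg_quadratic_linear_coeff_zero)
  then have "(\<Sum>i<n. (cmod (u i))\<^sup>2) = 0"
    unfolding cmod_power2 by (simp add: power2_eq_square)
  then show ?thesis
    using assms(3) by (auto simp: sum_nonneg_eq_0_iff u_def)
qed

lemma mat_app_add:
  "A \<in> carrier_mat n n \<Longrightarrow> B \<in> carrier_mat n n \<Longrightarrow> i < n \<Longrightarrow>
    mat_app n (A + B) z i = mat_app n A z i + mat_app n B z i"
  by (simp add: mat_app_def distrib_right sum.distrib)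

lemma mat_app_smult:
  "A \<in> carrier_mat n n \<Longrightarrow> i < n \<Longrightarrow> mat_app n (c \<cdot>\<^sub>m A) z i = c * mat_app n A z i"
  by (simp add: mat_app_def sum_distrib_left mult.assoc)

lemma mat_app_one: "i < n \<Longrightarrow> mat_app n (1\<^sub>m n) z i = z i"
  by (simp add: mat_app_def if_distrib[of "\<lambda>c. c * _"] cong: if_cong)

lemma quad_form_matrix_add:
  "A \<in> carrier_mat n n \<Longrightarrow> B \<in> carrier_mat n n \<Longrightarrow>
    quad_form n (A + B) z = quad_form n A z + quad_form n B z"
  by (simp add: quad_form_def mat_app_add distrib_left sum.distrib)

lemma quad_form_matrix_smult:
  "A \<in> carrier_mat n n \<Longrightarrow> quad_form n (c \<cdot>\<^sub>m A) z = c * quad_form n A z"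
  by (simp add: quad_form_def mat_app_smult sum_distrib_left mult_ac)

lemma quad_form_one: "quad_form n (1\<^sub>m n) z = of_real (\<Sum>i<n. (cmod (z i))\<^sup>2)"
  by (simp add: quad_form_def mat_app_one mult.commute complex_norm_square[symmetric] del: of_real_power)

lemma quad_form_scale_vec:
  "quad_form n A (\<lambda>i. of_real c * z i) = of_real (c\<^sup>2) * quad_form n A z"
  by (simp add: quad_form_def mat_app_def sum_distrib_left power2_eq_square mult_ac)

lemma form_nonneg_smult:
  assumes "form_nonneg n A" "0 \<le> c"
  shows "form_nonneg n (complex_of_real c \<cdot>\<^sub>m A)"
  using assms by (auto simp: form_nonneg_def hermitian_smult quad_form_matrix_smult[OF hermitian_carrier])

section \<open>Compactness and positive semidefiniteness\<close>

text \<open>Tychonoff's theorem gives compact sets of tuples whose length is not part of a type.\<close>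

lemma compact_bounded_families: "compact {x :: 'i \<Rightarrow> complex. \<forall>i. cmod (x i) \<le> 1}"
proof -
  have "compactin (product_topology (\<lambda>i::'i. euclidean) UNIV) (PiE UNIV (\<lambda>i. cball (0::complex) 1))"
    by (simp add: compactin_PiE)
  moreover have "PiE UNIV (\<lambda>i::'i. cball (0::complex) 1) = {x. \<forall>i. cmod (x i) \<le> 1}"
    by (auto simp: PiE_iff)
  ultimately show ?thesis
    by (simp add: euclidean_product_topology)
qed

lemma continuous_on_entry:
  "continuous_on S (\<lambda>x. x i :: 'b :: topological_space)"
  by (rule continuous_on_product_then_coordinatewise) (rule continuous_on_id)

lemma compact_unit_sphere:
  "compact {x :: nat \<Rightarrow> complex. (\<forall>i. cmod (x i) \<le> 1) \<and> (\<Sum>i<n. (cmod (x i))\<^sup>2) = 1}"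
proof -
  have "closed {x :: nat \<Rightarrow> complex. (\<Sum>i<n. (cmod (x i))\<^sup>2) = 1}"
    by (intro closed_Collect_eq continuous_on_sum continuous_on_power continuous_on_norm
        continuous_on_const continuous_on_entry)
  from compact_Int_closed[OF compact_bounded_families this] show ?thesis
    by (simp add: Int_def)
qed

text \<open>A minimizer of the form on the unit sphere minimizes the Rayleigh quotient on all vectors,
  by homogeneity of degree two.\<close>

lemma rayleigh_minimizer:
  assumes "0 < n" "A \<in> carrier_mat n n"
  obtains x where "(\<Sum>i<n. (cmod (x i))\<^sup>2) = 1"
    "\<And>z. Re (quad_form n A x) * (\<Sum>i<n. (cmod (z i))\<^sup>2) \<le> Re (quad_form n A z)"
proof -
  define K where "K = {x :: nat \<Rightarrow> complex. (\<forall>i. cmod (x i) \<le> 1) \<and> (\<Sum>i<n. (cmod (x i))\<^sup>2) = 1}"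
  have "(\<lambda>i. if i = 0 then 1 else 0) \<in> K"
    using \<open>0 < n\<close> by (auto simp: K_def if_distrib[of cmod] if_distrib[of "\<lambda>x. x\<^sup>2"] cong: if_cong)
  then have "K \<noteq> {}" by blast
  moreover have "continuous_on K (\<lambda>x. Re (quad_form n A x))"
    unfolding quad_form_def mat_app_def
    by (intro continuous_on_Re continuous_on_sum continuous_on_mult continuous_on_cnj
        continuous_on_const continuous_on_entry)
  moreover have "compact K"
    unfolding K_def by (rule compact_unit_sphere)
  ultimately have "\<exists>x\<in>K. \<forall>y\<in>K. Re (quad_form n A x) \<le> Re (quad_form n A y)"
    by (intro continuous_attains_inf)
  then obtain x where x: "x \<in> K" and min: "\<And>y. y \<in> K \<Longrightarrow> Re (quad_form n A x) \<le> Re (quad_form n A y)"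
    by metis
  have "Re (quad_form n A x) * (\<Sum>i<n. (cmod (z i))\<^sup>2) \<le> Re (quad_form n A z)" for z
  proof (cases "(\<Sum>i<n. (cmod (z i))\<^sup>2) = 0")
    case True
    then have "\<forall>i<n. z i = 0"
      by (auto simp: sum_nonneg_eq_0_iff)
    then show ?thesis
      using True by (simp add: quad_form_def)
  next
    case False
    define r where "r = sqrt (\<Sum>i<n. (cmod (z i))\<^sup>2)"
    have r: "r > 0" "r\<^sup>2 = (\<Sum>i<n. (cmod (z i))\<^sup>2)"
      using False by (auto simp: r_def sum_nonneg less_le)
    \<comment> \<open>Coordinates beyond \<open>n\<close> are set to zero to stay in the compact set.\<close>
    define y where "y = (\<lambda>i. if i < n then of_real (1 / r) * z i else 0)"
    have "(\<Sum>i<n. (cmod (y i))\<^sup>2) = (\<Sum>i<n. (1 / r\<^sup>2) * (cmod (z i))\<^sup>2)"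
      using r(1) by (intro sum.cong) (simp_all add: y_def norm_divide power_divide)
    also have "\<dots> = (1 / r\<^sup>2) * r\<^sup>2"
      unfolding r(2) by (rule sum_distrib_left[symmetric])
    finally have one: "(\<Sum>i<n. (cmod (y i))\<^sup>2) = 1"
      using r(1) by simp
    have "(cmod (y i))\<^sup>2 \<le> 1" if "i < n" for i
      unfolding one[symmetric] using that by (intro member_le_sum) auto
    then have "cmod (y i) \<le> 1" for i
      using abs_square_le_1[of "cmod (y i)"] by (cases "i < n") (auto simp: y_def)
    then have "Re (quad_form n A x) \<le> Re (quad_form n A y)"
      using one by (intro min) (auto simp: K_def)
    also have "quad_form n A y = quad_form n A (\<lambda>i. of_real (1 / r) * z i)"
      by (simp add: quad_form_def mat_app_def y_def)
    also have "\<dots> = of_real ((1 / r)\<^sup>2) * quad_form n A z"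
      by (rule quad_form_scale_vec)
    finally have "Re (quad_form n A x) \<le> (1 / r)\<^sup>2 * Re (quad_form n A z)"
      by (simp del: of_real_power)
    then show ?thesis
      using r(1) by (simp add: power_divide field_simps flip: r(2))
  qed
  with x show ?thesis
    using that by (auto simp: K_def)
qed

text \<open>If \<open>c\<close> is the minimum of the Rayleigh quotient of \<open>A\<close>, then \<open>A - c\<close> has a nonnegative form which
  degenerates at the minimizer. So the minimizer is an eigenvector of \<open>A\<close> for \<open>c\<close>, and \<open>c \<ge> 0\<close>.\<close>

lemma form_nonneg_if_psd:
  assumes "0 < n" and A: "psd_mat n A"
  shows "form_nonneg n A"
proof -
  have herm: "hermitian_mat n A" and Ac: "A \<in> carrier_mat n n"
    using A by (auto simp: psd_mat_def hermitian_mat_def)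
  from rayleigh_minimizer[OF \<open>0 < n\<close> Ac] obtain x where
    x: "(\<Sum>i<n. (cmod (x i))\<^sup>2) = 1" and
    min: "\<And>z. Re (quad_form n A x) * (\<Sum>i<n. (cmod (z i))\<^sup>2) \<le> Re (quad_form n A z)"
    by blast
  define c where "c = Re (quad_form n A x)"
  \<comment> \<open>the shifted form, nonnegative and degenerate at \<open>x\<close>\<close>
  define W where "W = A + complex_of_real (- c) \<cdot>\<^sub>m 1\<^sub>m n"
  have qW: "Re (quad_form n W z) = Re (quad_form n A z) - c * (\<Sum>i<n. (cmod (z i))\<^sup>2)" for z
    using Ac by (simp add: W_def quad_form_matrix_add quad_form_matrix_smult quad_form_one)
  have W: "form_nonneg n W"
    using min herm unfolding form_nonneg_def qW
    by (auto simp: W_def c_def intro!: hermitian_add hermitian_smult hermitian_one simp del: of_real_minus)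
  have "mat_app n W x i = 0" if "i < n" for i
    using mat_app_zero_if_quad_form_zero[OF W _ that, of x] x by (simp add: qW c_def)
  then have ev: "mat_app n A x i = of_real c * x i" if "i < n" for i
    using that Ac by (simp add: W_def mat_app_add mat_app_smult mat_app_one)
  have "eigenvector A (vec n x) (of_real c)"
  proof -
    have "vec n x \<noteq> 0\<^sub>v n"
    proof
      assume "vec n x = 0\<^sub>v n"
      then have "x i = 0" if "i < n" for i
        using that by (metis index_vec index_zero_vec(1))
      then show False using x by simp
    qed
    moreover have "A *\<^sub>v vec n x = of_real c \<cdot>\<^sub>v vec n x"
      using Ac ev by (intro eq_vecI) (auto simp: mat_app_def scalar_prod_def atLeast0LessThan)
    ultimately show ?thesis
      using Ac by (auto simp: eigenvector_def)
  qed
  then have "complex_of_real c \<in> \<real>\<^sub>\<ge>\<^sub>0"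
    using A by (auto simp: psd_mat_def eigenvalue_def)
  then have "0 \<le> c" by simp
  then have "0 \<le> Re (quad_form n A z)" for z
    using min[of z] by (smt (verit, best) c_def mult_nonneg_nonneg sum_nonneg zero_le_power2)
  with herm show ?thesis
    by (simp add: form_nonneg_def)
qed

lemma psd_if_form_nonneg:
  assumes A: "form_nonneg n A"
  shows "psd_mat n A"
proof -
  have herm: "hermitian_mat n A" and Ac: "A \<in> carrier_mat n n"
    using A by (auto simp: form_nonneg_def hermitian_mat_def)
  have "k \<in> \<real>\<^sub>\<ge>\<^sub>0" if k: "eigenvalue A k" for k
  proof -
    obtain v where v: "v \<in> carrier_vec n" "v \<noteq> 0\<^sub>v n" "A *\<^sub>v v = k \<cdot>\<^sub>v v"
      using k Ac by (auto simp: eigenvalue_def eigenvector_def)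
    define s where "s = (\<Sum>i<n. (cmod (v $ i))\<^sup>2)"
    have "\<exists>i<n. v $ i \<noteq> 0"
    proof (rule ccontr)
      assume "\<not> (\<exists>i<n. v $ i \<noteq> 0)"
      then have "v = 0\<^sub>v n" using v(1) by (intro eq_vecI) auto
      with v(2) show False by simp
    qed
    then obtain i where "i < n" "v $ i \<noteq> 0" by blast
    then have s: "s > 0"
      unfolding s_def by (intro sum_pos2[of _ i]) auto
    have "mat_app n A (\<lambda>i. v $ i) i = k * v $ i" if "i < n" for i
    proof -
      have "(A *\<^sub>v v) $ i = (k \<cdot>\<^sub>v v) $ i" using v(3) by simp
      then show ?thesis
        using that v(1) Ac by (simp add: mat_app_def scalar_prod_def atLeast0LessThan)
    qed
    then have q: "quad_form n A (\<lambda>i. v $ i) = k * of_real s"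
      by (simp add: quad_form_def s_def sum_distrib_left complex_norm_square mult_ac del: of_real_power)
    have "quad_form n A (\<lambda>i. v $ i) = cnj (quad_form n A (\<lambda>i. v $ i))"
      unfolding quad_form_def by (rule inner_hermitian[OF herm])
    then have "Im (quad_form n A (\<lambda>i. v $ i)) = 0"
      by (metis Reals_cnj_iff complex_is_Real_iff)
    then have "Im k = 0" using s by (simp add: q)
    moreover have "0 \<le> Re (k * of_real s)"
      using A unfolding form_nonneg_def q[symmetric] by blast
    then have "0 \<le> Re k"
      using s by (simp add: zero_le_mult_iff)
    ultimately show ?thesis
      by (simp add: complex_nonneg_Reals_iff)
  qed
  with herm show ?thesis
    by (simp add: psd_mat_def)
qed

section \<open>Sums of words and their traces\<close>

declare pow_mat.simps [simp del]

text \<open>The matrix \<open>A + t B\<close> over the polynomials in \<open>t\<close>.\<close>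

definition pencil :: "complex mat \<Rightarrow> complex mat \<Rightarrow> complex poly mat"
  where "pencil A B = map_mat (\<lambda>a. [:a:]) A + [:0, 1:] \<cdot>\<^sub>m map_mat (\<lambda>b. [:b:]) B"

definition coeff_mat :: "nat \<Rightarrow> complex poly mat \<Rightarrow> complex mat"
  where "coeff_mat k P = map_mat (\<lambda>p. coeff p k) P"

text \<open>The coefficient of \<open>t ^ k\<close> in \<open>t P\<close>. It supplies the missing case \<open>k = 0\<close> of the
  coefficient with index \<open>k - 1\<close>, where truncated subtraction would give a wrong value.\<close>

definition coeff_mat_pred :: "nat \<Rightarrow> complex poly mat \<Rightarrow> complex mat"
  where "coeff_mat_pred k P = (if k = 0 then 0\<^sub>m (dim_row P) (dim_col P) else coeff_mat (k - 1) P)"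

text \<open>The sum of all products of \<open>m\<close> factors of which \<open>k\<close> are equal to \<open>B\<close> and the others to \<open>A\<close>.\<close>

abbreviation word_sum :: "nat \<Rightarrow> nat \<Rightarrow> complex mat \<Rightarrow> complex mat \<Rightarrow> complex mat"
  where "word_sum m k A B \<equiv> coeff_mat k (pencil A B ^\<^sub>m m)"

abbreviation word_sum_pred :: "nat \<Rightarrow> nat \<Rightarrow> complex mat \<Rightarrow> complex mat \<Rightarrow> complex mat"
  where "word_sum_pred m k A B \<equiv> coeff_mat_pred k (pencil A B ^\<^sub>m m)"

lemma pencil_carrier [simp]:
  "A \<in> carrier_mat n n \<Longrightarrow> B \<in> carrier_mat n n \<Longrightarrow> pencil A B \<in> carrier_mat n n"
  by (auto simp: pencil_def)

lemma coeff_mat_carrier [simp]: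
  "P \<in> carrier_mat n n \<Longrightarrow> coeff_mat k P \<in> carrier_mat n n"
  "P \<in> carrier_mat n n \<Longrightarrow> coeff_mat_pred k P \<in> carrier_mat n n"
  by (auto simp: coeff_mat_def coeff_mat_pred_def)

lemma coeff_mat_dim [simp]:
  "dim_row (coeff_mat k P) = dim_row P" "dim_col (coeff_mat k P) = dim_col P"
  "dim_row (coeff_mat_pred k P) = dim_row P" "dim_col (coeff_mat_pred k P) = dim_col P"
  by (auto simp: coeff_mat_def coeff_mat_pred_def)

lemma pencil_entry:
  "A \<in> carrier_mat n n \<Longrightarrow> B \<in> carrier_mat n n \<Longrightarrow> i < n \<Longrightarrow> j < n \<Longrightarrow>
    pencil A B $$ (i, j) = [:A $$ (i, j), B $$ (i, j):]"
  by (simp add: pencil_def)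

lemma coeff_mat_entry:
  "P \<in> carrier_mat n n \<Longrightarrow> i < n \<Longrightarrow> j < n \<Longrightarrow> coeff_mat k P $$ (i, j) = coeff (P $$ (i, j)) k"
  "P \<in> carrier_mat n n \<Longrightarrow> i < n \<Longrightarrow> j < n \<Longrightarrow>
    coeff_mat_pred k P $$ (i, j) = (if k = 0 then 0 else coeff (P $$ (i, j)) (k - 1))"
  by (auto simp: coeff_mat_def coeff_mat_pred_def)

lemma coeff_mat_pred_simps:
  "P \<in> carrier_mat n n \<Longrightarrow> coeff_mat_pred 0 P = 0\<^sub>m n n"
  "coeff_mat_pred (Suc k) P = coeff_mat k P"
  by (auto simp: coeff_mat_pred_def)

lemma trace_coeff_mat:
  "P \<in> carrier_mat n n \<Longrightarrow> mat_trace (coeff_mat k P) = coeff (mat_trace P) k"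
  by (simp add: trace_eq_sum[where n = n] coeff_mat_entry coeff_sum)

lemma coeff_bmv_poly:
  assumes "A \<in> carrier_mat n n" "B \<in> carrier_mat n n"
  shows "coeff (bmv_poly m A B) k = mat_trace (word_sum m k A B)"
  using assms by (simp add: trace_coeff_mat[where n = n] bmv_poly_def pencil_def)

lemma coeff_mat_mult_pencil:
  assumes P: "P \<in> carrier_mat n n" and A: "A \<in> carrier_mat n n" and B: "B \<in> carrier_mat n n"
  shows "coeff_mat k (P * pencil A B) = coeff_mat k P * A + coeff_mat_pred k P * B"
proof (rule eq_matI)
  fix i j assume "i < dim_row (coeff_mat k P * A + coeff_mat_pred k P * B)"
    "j < dim_col (coeff_mat k P * A + coeff_mat_pred k P * B)"
  then have ij: "i < n" "j < n"
    using assms by (auto simp: coeff_mat_def coeff_mat_pred_def split: if_splits)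
  have "coeff (p * [:a, b:]) k = coeff p k * a + (if k = 0 then 0 else coeff p (k - 1)) * b"
    for p :: "complex poly" and a b
    by (cases k) (simp_all add: mult_pCons_right algebra_simps)
  then show "coeff_mat k (P * pencil A B) $$ (i, j) = (coeff_mat k P * A + coeff_mat_pred k P * B) $$ (i, j)"
    using ij assms
    by (simp add: coeff_mat_entry[where n = n] mult_entry[where n = n] pencil_entry[where n = n]
        coeff_sum sum.distrib del: index_mult_mat(1) mult_pCons_right)
qed (use assms in \<open>auto simp: coeff_mat_def coeff_mat_pred_def pencil_def\<close>)

lemma coeff_mat_pencil_mult:
  assumes P: "P \<in> carrier_mat n n" and A: "A \<in> carrier_mat n n" and B: "B \<in> carrier_mat n n"
  shows "coeff_mat k (pencil A B * P) = A * coeff_mat k P + B * coeff_mat_pred k P"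
proof (rule eq_matI)
  fix i j assume "i < dim_row (A * coeff_mat k P + B * coeff_mat_pred k P)"
    "j < dim_col (A * coeff_mat k P + B * coeff_mat_pred k P)"
  then have ij: "i < n" "j < n"
    using assms by (auto simp: coeff_mat_def coeff_mat_pred_def split: if_splits)
  have "coeff ([:a, b:] * p) k = a * coeff p k + b * (if k = 0 then 0 else coeff p (k - 1))"
    for p :: "complex poly" and a b
    by (cases k) (simp_all add: algebra_simps)
  then show "coeff_mat k (pencil A B * P) $$ (i, j) = (A * coeff_mat k P + B * coeff_mat_pred k P) $$ (i, j)"
    using ij assms mult_carrier_mat[OF pencil_carrier[OF A B] P]
    by (simp add: coeff_mat_entry[where n = n] mult_entry[where n = n] pencil_entry[where n = n]
        coeff_sum sum.distrib del: index_mult_mat(1) mult_pCons_left)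
qed (use assms in \<open>auto simp: coeff_mat_def coeff_mat_pred_def pencil_def\<close>)

lemma pow_mat_mult_pow_mat:
  fixes M :: "'a :: comm_semiring_1 mat"
  assumes M: "M \<in> carrier_mat n n"
  shows "M ^\<^sub>m i * M ^\<^sub>m j = M ^\<^sub>m (i + j)"
proof (induction j)
  case 0
  then show ?case using M by (simp add: pow_mat.simps)
next
  case (Suc j)
  have "M ^\<^sub>m i * M ^\<^sub>m Suc j = M ^\<^sub>m i * M ^\<^sub>m j * M"
    using M by (simp add: pow_mat.simps assoc_mult_mat[of _ n n _ n _ n])
  with Suc show ?case by (simp add: pow_mat.simps)
qed

lemma pow_mat_Suc_left:
  fixes M :: "'a :: comm_semiring_1 mat"
  assumes M: "M \<in> carrier_mat n n"
  shows "M ^\<^sub>m Suc i = M * M ^\<^sub>m i"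
  using pow_mat_mult_pow_mat[OF M, of 1 i] M by (simp add: pow_mat.simps)

lemma word_sum_Suc:
  assumes "A \<in> carrier_mat n n" "B \<in> carrier_mat n n"
  shows "word_sum (Suc m) k A B = word_sum m k A B * A + word_sum_pred m k A B * B"
  using assms by (simp add: pow_mat.simps coeff_mat_mult_pencil[where n = n])

lemma word_sum_Suc_left:
  assumes "A \<in> carrier_mat n n" "B \<in> carrier_mat n n"
  shows "word_sum (Suc m) k A B = A * word_sum m k A B + B * word_sum_pred m k A B"
  unfolding pow_mat_Suc_left[OF pencil_carrier[OF assms]] 
  using assms by (intro coeff_mat_pencil_mult[where n = n]) auto

lemma word_sum_zero:
  assumes "A \<in> carrier_mat n n" "B \<in> carrier_mat n n"
  shows "word_sum 0 k A B = (if k = 0 then 1\<^sub>m n else 0\<^sub>m n n)"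
  using assms by (auto simp: pow_mat.simps coeff_mat_def pencil_def intro!: eq_matI)

text \<open>Reversing words permutes the summands; in the induction this is the passage between
  splitting off the last and the first letter.\<close>

lemma hermitian_word_sum:
  assumes A: "hermitian_mat n A" and B: "hermitian_mat n B"
  shows "hermitian_mat n (word_sum m k A B)"
proof (induction m arbitrary: k)
  case 0
  then show ?case
    using assms[THEN hermitian_carrier] by (auto simp: word_sum_zero[where n = n] hermitian_one intro!: hermitianI)
next
  case (Suc m)
  note [simp] = assms[THEN hermitian_carrier]
  have [simp]: "mat_adjoint A = A" "mat_adjoint B = B" "mat_adjoint (word_sum m k A B) = word_sum m k A B" for k
    using A B Suc by (auto simp: hermitian_mat_def)
  have [simp]: "mat_adjoint (word_sum_pred m k A B) = word_sum_pred m k A B"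
    by (cases k) (auto simp: coeff_mat_pred_simps(1)[where n = n] coeff_mat_pred_simps(2) adjoint_entry[where n = n] intro!: eq_matI)
  have "mat_adjoint (word_sum (Suc m) k A B) = A * word_sum m k A B + B * word_sum_pred m k A B"
    using mult_carrier_mat[of "word_sum m k A B" n n A n] mult_carrier_mat[of "word_sum_pred m k A B" n n B n]
    by (simp add: word_sum_Suc[where n = n] adjoint_add[where n = n] adjoint_mult[where n = n])
  also have "\<dots> = word_sum (Suc m) k A B"
    by (rule word_sum_Suc_left[of _ n, symmetric]) auto
  finally show ?case
    by (simp add: hermitian_mat_def)
qed

lemma word_sum_eq_zero:
  assumes "A \<in> carrier_mat n n" "B \<in> carrier_mat n n" "m < k"
  shows "word_sum m k A B = 0\<^sub>m n n"
  using assms(3)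
proof (induction m arbitrary: k)
  case 0
  then show ?case using assms(1,2) by (simp add: word_sum_zero)
next
  case (Suc m)
  then show ?case
    unfolding word_sum_Suc[OF assms(1,2)] using assms(1,2) by (simp add: coeff_mat_pred_def)
qed

lemma word_sum_smult:
  assumes A: "A \<in> carrier_mat n n" and B: "B \<in> carrier_mat n n" and "k \<le> m"
  shows "word_sum m k (a \<cdot>\<^sub>m A) (b \<cdot>\<^sub>m B) = (a ^ (m - k) * b ^ k) \<cdot>\<^sub>m word_sum m k A B"
  using assms(3)
proof (induction m arbitrary: k)
  case 0
  then show ?case using A B by (auto simp: word_sum_zero[where n = n] intro!: eq_matI)
next
  case (Suc m)
  have aA: "a \<cdot>\<^sub>m A \<in> carrier_mat n n" and bB: "b \<cdot>\<^sub>m B \<in> carrier_mat n n"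
    using A B by auto
  define W where "W = word_sum m k A B * A"
  define V where "V = word_sum_pred m k A B * B"
  have c: "W \<in> carrier_mat n n" "V \<in> carrier_mat n n"
    using A B by (auto simp: W_def V_def intro!: mult_carrier_mat[of _ n n])
  have 1: "word_sum m k (a \<cdot>\<^sub>m A) (b \<cdot>\<^sub>m B) * (a \<cdot>\<^sub>m A) = (a ^ (Suc m - k) * b ^ k) \<cdot>\<^sub>m W"
  proof (cases "k \<le> m")
    case True
    then show ?thesis
      unfolding Suc.IH[OF True] W_def using A B
      by (simp add: Suc_diff_le mult_smult_assoc_mat[of _ n n _ n] mult_smult_distrib[of _ n n _ n]
        smult_smult_mat mult_ac)
  next
    case False
    then show ?thesis
      unfolding W_def using A B by (simp add: word_sum_eq_zero[where n = n])
  qed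
  have 2: "word_sum_pred m k (a \<cdot>\<^sub>m A) (b \<cdot>\<^sub>m B) * (b \<cdot>\<^sub>m B) = (a ^ (Suc m - k) * b ^ k) \<cdot>\<^sub>m V"
  proof (cases k)
    case 0
    then show ?thesis
      unfolding V_def using A B by (simp add: coeff_mat_pred_simps(1)[where n = n] coeff_mat_pred_simps(2))
  next
    case (Suc k')
    with Suc.prems have "k' \<le> m" by simp
    then show ?thesis
      unfolding V_def using Suc Suc.IH[of k'] A B
      by (simp add: coeff_mat_pred_simps mult_smult_assoc_mat[of _ n n _ n] mult_smult_distrib[of _ n n _ n]
        smult_smult_mat mult_ac)
  qed
  show ?case
    unfolding word_sum_Suc[OF A B] word_sum_Suc[OF aA bB] 1 2
    using c by (simp add: W_def[symmetric] V_def[symmetric] add_smult_distrib_left_mat[of _ n n])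
qed

section \<open>Continuity, derivatives and Euler identities\<close>

lemma mult_add_mult_entry:
  "A \<in> carrier_mat n n \<Longrightarrow> B \<in> carrier_mat n n \<Longrightarrow> C \<in> carrier_mat n n \<Longrightarrow> D \<in> carrier_mat n n \<Longrightarrow>
    i < n \<Longrightarrow> j < n \<Longrightarrow>
    (A * B + C * D) $$ (i, j) = (\<Sum>l<n. A $$ (i, l) * B $$ (l, j)) + (\<Sum>l<n. C $$ (i, l) * D $$ (l, j))"
  by (simp add: mult_entry[where n = n] del: index_mult_mat(1))

lemma continuous_on_word_sum:
  assumes F: "\<And>x. F x \<in> carrier_mat n n" "\<And>i j. i < n \<Longrightarrow> j < n \<Longrightarrow> continuous_on S (\<lambda>x. F x $$ (i, j))"
    and G: "\<And>x. G x \<in> carrier_mat n n" "\<And>i j. i < n \<Longrightarrow> j < n \<Longrightarrow> continuous_on S (\<lambda>x. G x $$ (i, j))"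
    and "i < n" "j < n"
  shows "continuous_on S (\<lambda>x. word_sum m k (F x) (G x) $$ (i, j))"
  using assms(5,6)
proof (induction m arbitrary: k i j)
  case 0
  then show ?case
    using F G by (simp add: word_sum_zero[where n = n])
next
  case (Suc m)
  have pred: "continuous_on S (\<lambda>x. word_sum_pred m k (F x) (G x) $$ (i, j))" if "i < n" "j < n" for i j
    using that Suc.IH F(1) G(1)
    by (cases k) (simp_all add: coeff_mat_pred_simps(1)[where n = n] coeff_mat_pred_simps(2))
  have eq: "word_sum (Suc m) k (F x) (G x) $$ (i, j) =
      (\<Sum>l<n. word_sum m k (F x) (G x) $$ (i, l) * F x $$ (l, j)) +
      (\<Sum>l<n. word_sum_pred m k (F x) (G x) $$ (i, l) * G x $$ (l, j))" for x
    unfolding word_sum_Suc[OF F(1) G(1)] using F(1) G(1) Suc.prems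
    by (intro mult_add_mult_entry) auto
  show ?case
    unfolding eq
    by (intro continuous_on_add continuous_on_sum continuous_on_mult)
      (use F G Suc pred in auto)
qed

text \<open>The derivative of \<open>M ^ m\<close> in direction \<open>N\<close>, as given by the product rule.\<close>

fun pow_deriv :: "'a :: comm_semiring_1 mat \<Rightarrow> 'a mat \<Rightarrow> nat \<Rightarrow> 'a mat" where
  "pow_deriv M N 0 = 0\<^sub>m (dim_row M) (dim_row M)"
| "pow_deriv M N (Suc m) = pow_deriv M N m * M + M ^\<^sub>m m * N"

lemma pow_deriv_carrier [simp]:
  "M \<in> carrier_mat n n \<Longrightarrow> N \<in> carrier_mat n n \<Longrightarrow> pow_deriv M N m \<in> carrier_mat n n"
  by (induction m) (auto intro!: mult_carrier_mat[of _ n n])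

text \<open>By cyclicity of the trace all \<open>m\<close> positions of the letter \<open>N\<close> contribute equally. The extra
  factor \<open>M ^ j\<close> makes the induction go through.\<close>

lemma trace_pow_deriv_mult_pow:
  assumes M: "M \<in> carrier_mat n n" and N: "N \<in> carrier_mat n n"
  shows "mat_trace (pow_deriv M N m * M ^\<^sub>m j) = of_nat m * mat_trace (M ^\<^sub>m (m + j - 1) * N)"
proof (induction m arbitrary: j)
  case 0
  have "0\<^sub>m n n * M ^\<^sub>m j = 0\<^sub>m n n"
    using M by (intro left_mult_zero_mat) auto
  then show ?case
    using M by (simp add: mat_trace_def)
next
  case (Suc m)
  define P where "P = M ^\<^sub>m m"
  define Q where "Q = M ^\<^sub>m j"
  have PQ: "P \<in> carrier_mat n n" "Q \<in> carrier_mat n n"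
    using M by (auto simp: P_def Q_def)
  have PN: "P * N \<in> carrier_mat n n"
    using PQ N by simp
  have D: "pow_deriv M N m \<in> carrier_mat n n" using M N by simp
  have "mat_trace (pow_deriv M N (Suc m) * Q)
      = mat_trace (pow_deriv M N m * (M * Q)) + mat_trace (P * N * Q)"
  proof -
    have "pow_deriv M N (Suc m) * Q = pow_deriv M N m * M * Q + P * N * Q"
      unfolding pow_deriv.simps P_def[symmetric]
      using D M PN PQ by (intro add_mult_distrib_mat[of _ n n]) auto
    also have "pow_deriv M N m * M * Q = pow_deriv M N m * (M * Q)"
      by (rule assoc_mult_mat[OF D M PQ(2)])
    finally show ?thesis
      using D M PN PQ by (simp add: trace_add[where n = n])
  qed
  also have "M * Q = M ^\<^sub>m Suc j"
    by (simp add: Q_def pow_mat_Suc_left[OF M])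
  also have "mat_trace (pow_deriv M N m * M ^\<^sub>m Suc j) = of_nat m * mat_trace (M ^\<^sub>m (m + j) * N)"
    using Suc.IH[of "Suc j"] by simp
  also have "mat_trace (P * N * Q) = mat_trace (Q * (P * N))"
    by (rule trace_mult_commute[OF PN PQ(2)])
  also have "Q * (P * N) = Q * P * N"
    using PQ N by (simp add: assoc_mult_mat[of _ n n _ n _ n])
  also have "Q * P = M ^\<^sub>m (m + j)"
    by (simp add: P_def Q_def pow_mat_mult_pow_mat[OF M] add.commute)
  finally show ?case
    by (simp add: Q_def distrib_right add.commute)
qed

lemma trace_pow_deriv:
  assumes M: "M \<in> carrier_mat n n" and N: "N \<in> carrier_mat n n"
  shows "mat_trace (pow_deriv M N m) = of_nat m * mat_trace (M ^\<^sub>m (m - 1) * N)"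
  using trace_pow_deriv_mult_pow[OF assms, of m 0] M pow_deriv_carrier[OF M N, of m]
  by (simp add: pow_mat.simps)

lemma coeff_mat_add:
  "P \<in> carrier_mat n n \<Longrightarrow> Q \<in> carrier_mat n n \<Longrightarrow> coeff_mat k (P + Q) = coeff_mat k P + coeff_mat k Q"
  by (rule eq_matI) (auto simp: coeff_mat_entry[where n = n])

text \<open>Only derivatives of complex-valued functions are involved: the polynomial
  variable of the pencil is handled coefficient by coefficient.\<close>

lemma word_sum_has_vector_derivative:
  fixes F G :: "real \<Rightarrow> complex mat"
  assumes F: "\<And>x. F x \<in> carrier_mat n n" "H \<in> carrier_mat n n"
      "\<And>i j. i < n \<Longrightarrow> j < n \<Longrightarrow> ((\<lambda>x. F x $$ (i, j)) has_vector_derivative H $$ (i, j)) (at 0)"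
    and G: "\<And>x. G x \<in> carrier_mat n n" "K \<in> carrier_mat n n"
      "\<And>i j. i < n \<Longrightarrow> j < n \<Longrightarrow> ((\<lambda>x. G x $$ (i, j)) has_vector_derivative K $$ (i, j)) (at 0)"
    and "i < n" "j < n"
  shows "((\<lambda>x. word_sum m k (F x) (G x) $$ (i, j)) has_vector_derivative
    coeff_mat k (pow_deriv (pencil (F 0) (G 0)) (pencil H K) m) $$ (i, j)) (at 0)"
  using assms(7,8)
proof (induction m arbitrary: k i j)
  case 0
  have "pencil (F 0) (G 0) \<in> carrier_mat n n" using F(1) G(1) by simp
  then have "dim_row (pencil (F 0) (G 0)) = n" by blast
  then show ?case
    using F(1) G(1) 0 by (simp add: word_sum_zero[where n = n] coeff_mat_entry(1)[OF zero_carrier_mat])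
next
  case (Suc m)
  let ?M = "pencil (F 0) (G 0)" and ?N = "pencil H K"
  let ?D = "pow_deriv ?M ?N m"
  have M: "?M \<in> carrier_mat n n" and N: "?N \<in> carrier_mat n n"
    using F G by auto
  have D: "?D \<in> carrier_mat n n" using M N by simp
  have pred: "((\<lambda>x. word_sum_pred m k (F x) (G x) $$ (i, j)) has_vector_derivative
      coeff_mat_pred k ?D $$ (i, j)) (at 0)" if "i < n" "j < n" for i j
    using that Suc.IH F(1) G(1) D
    by (cases k) (simp_all add: coeff_mat_pred_simps(1)[where n = n] coeff_mat_pred_simps(2))
  have eq: "word_sum (Suc m) k (F x) (G x) $$ (i, j) =
      (\<Sum>l<n. word_sum m k (F x) (G x) $$ (i, l) * F x $$ (l, j)) +
      (\<Sum>l<n. word_sum_pred m k (F x) (G x) $$ (i, l) * G x $$ (l, j))" for x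
    unfolding word_sum_Suc[OF F(1) G(1)] using F(1) G(1) Suc.prems
    by (intro mult_add_mult_entry) auto
  have MN: "?M ^\<^sub>m m * ?N \<in> carrier_mat n n" "?D * ?M \<in> carrier_mat n n"
    using M N D by auto
  have *: "coeff_mat k (pow_deriv ?M ?N (Suc m)) =
      (coeff_mat k ?D * F 0 + coeff_mat_pred k ?D * G 0) +
      (word_sum m k (F 0) (G 0) * H + word_sum_pred m k (F 0) (G 0) * K)"
    using MN F G D M by (simp add: coeff_mat_add[where n = n] coeff_mat_mult_pencil[where n = n])
  have eq': "coeff_mat k (pow_deriv ?M ?N (Suc m)) $$ (i, j) =
      (\<Sum>l<n. word_sum m k (F 0) (G 0) $$ (i, l) * H $$ (l, j) + coeff_mat k ?D $$ (i, l) * F 0 $$ (l, j)) +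
      (\<Sum>l<n. word_sum_pred m k (F 0) (G 0) $$ (i, l) * K $$ (l, j) + coeff_mat_pred k ?D $$ (i, l) * G 0 $$ (l, j))"
  proof -
    have add_entry: "(X + Y) $$ (i, j) = X $$ (i, j) + Y $$ (i, j)"
      if "X \<in> carrier_mat n n" "Y \<in> carrier_mat n n" for X Y :: "complex mat"
      using that Suc.prems by simp
    show ?thesis
      unfolding * using F(1,2) G(1,2) D M Suc.prems
      by (simp add: add_entry mult_entry[where n = n] sum.distrib add_ac del: index_add_mat index_mult_mat)
  qed
  show ?case
    unfolding eq eq'
    by (intro has_vector_derivative_add has_vector_derivative_sum has_vector_derivative_mult)
      (use F G Suc pred in auto)
qed

lemma trace_word_sum_has_vector_derivative:
  fixes F G :: "real \<Rightarrow> complex mat"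
  assumes F: "\<And>x. F x \<in> carrier_mat n n" "H \<in> carrier_mat n n"
      "\<And>i j. i < n \<Longrightarrow> j < n \<Longrightarrow> ((\<lambda>x. F x $$ (i, j)) has_vector_derivative H $$ (i, j)) (at 0)"
    and G: "\<And>x. G x \<in> carrier_mat n n" "K \<in> carrier_mat n n"
      "\<And>i j. i < n \<Longrightarrow> j < n \<Longrightarrow> ((\<lambda>x. G x $$ (i, j)) has_vector_derivative K $$ (i, j)) (at 0)"
  shows "((\<lambda>x. mat_trace (word_sum (Suc m) k (F x) (G x))) has_vector_derivative
    of_nat (Suc m) * (mat_trace (word_sum m k (F 0) (G 0) * H) + mat_trace (word_sum_pred m k (F 0) (G 0) * K)))
    (at 0)"
proof -
  let ?M = "pencil (F 0) (G 0)" and ?N = "pencil H K"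
  have M: "?M \<in> carrier_mat n n" and N: "?N \<in> carrier_mat n n"
    using F G by auto
  let ?D = "pow_deriv ?M ?N (Suc m)"
  have "((\<lambda>x. \<Sum>i<n. word_sum (Suc m) k (F x) (G x) $$ (i, i)) has_vector_derivative
      (\<Sum>i<n. coeff_mat k ?D $$ (i, i))) (at 0)"
    by (intro has_vector_derivative_sum word_sum_has_vector_derivative) (use F G in auto)
  also have "(\<Sum>i<n. coeff_mat k ?D $$ (i, i)) = mat_trace (coeff_mat k ?D)"
    using M N by (intro trace_eq_sum[symmetric] coeff_mat_carrier pow_deriv_carrier)
  also have "\<dots> = coeff (mat_trace ?D) k"
    using M N by (intro trace_coeff_mat pow_deriv_carrier)
  also have "mat_trace ?D = smult (of_nat (Suc m)) (mat_trace (?M ^\<^sub>m m * ?N))"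
    unfolding trace_pow_deriv[OF M N] by (simp add: of_nat_poly)
  also have "coeff \<dots> k = of_nat (Suc m) * mat_trace (coeff_mat k (?M ^\<^sub>m m * ?N))"
    using mult_carrier_mat[OF pow_carrier_mat[OF M] N] by (simp add: trace_coeff_mat[where n = n])
  also have "coeff_mat k (?M ^\<^sub>m m * ?N) = word_sum m k (F 0) (G 0) * H + word_sum_pred m k (F 0) (G 0) * K"
    using F G M by (intro coeff_mat_mult_pencil) auto
  also have "mat_trace \<dots> = mat_trace (word_sum m k (F 0) (G 0) * H) + mat_trace (word_sum_pred m k (F 0) (G 0) * K)"
    using F G M by (intro trace_add[where n = n]) auto
  finally show ?thesis
    using F G by (simp add: trace_eq_sum[where n = n])
qed

lemma has_vector_derivative_unique:
  assumes "(f has_vector_derivative a) (at x)" "(f has_vector_derivative b) (at x)"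
  shows "a = b"
proof -
  have "(\<lambda>h. h *\<^sub>R a) = (\<lambda>h. h *\<^sub>R b)"
    using assms unfolding has_vector_derivative_def by (rule has_derivative_unique)
  from fun_cong[OF this, of 1] show ?thesis by simp
qed

lemma smult_line_has_vector_derivative:
  assumes "A \<in> carrier_mat n n" "i < n" "j < n"
  shows "((\<lambda>x. (complex_of_real (1 + x) \<cdot>\<^sub>m A) $$ (i, j)) has_vector_derivative A $$ (i, j)) (at 0)"
proof -
  have "((\<lambda>x. complex_of_real (1 + x) * A $$ (i, j)) has_vector_derivative A $$ (i, j)) (at 0)"
    by (auto intro!: derivative_eq_intros)
  then show ?thesis using assms by simp
qed

lemma power_line_has_vector_derivative:
  "((\<lambda>x. complex_of_real ((1 + x) ^ p) * c) has_vector_derivative of_nat p * c) (at 0)"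
proof -
  have "((\<lambda>x::real. (1 + x) ^ p) has_vector_derivative real p) (at 0)"
    unfolding has_real_derivative_iff_has_vector_derivative[symmetric]
    by (auto intro!: derivative_eq_intros)
  then have "((\<lambda>x. complex_of_real ((1 + x) ^ p)) has_vector_derivative complex_of_real (real p)) (at 0)"
    by (rule bounded_linear.has_vector_derivative[OF bounded_linear_of_real])
  from has_vector_derivative_mult_left[OF this, of c] show ?thesis by simp
qed

text \<open>Euler's identity for the first matrix: differentiate \<open>Tr S(s A, B) = s ^ p Tr S(A, B)\<close> at \<open>s = 1\<close>, where \<open>p\<close> is the
  number of letters \<open>A\<close> in each word.\<close>

lemma euler_left:
  assumes A: "A \<in> carrier_mat n n" and B: "B \<in> carrier_mat n n" and "k \<le> Suc m"
  shows "of_nat (Suc m) * mat_trace (word_sum m k A B * A)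
    = of_nat (Suc m - k) * mat_trace (word_sum (Suc m) k A B)"
proof -
  have "((\<lambda>x. mat_trace (word_sum (Suc m) k (complex_of_real (1 + x) \<cdot>\<^sub>m A) (1 \<cdot>\<^sub>m B))) has_vector_derivative
    of_nat (Suc m) * (mat_trace (word_sum m k (complex_of_real (1 + 0) \<cdot>\<^sub>m A) (1 \<cdot>\<^sub>m B) * A)
      + mat_trace (word_sum_pred m k (complex_of_real (1 + 0) \<cdot>\<^sub>m A) (1 \<cdot>\<^sub>m B) * 0\<^sub>m n n))) (at 0)"
    using A B by (intro trace_word_sum_has_vector_derivative[where n = n] smult_line_has_vector_derivative) auto
  moreover have "mat_trace (word_sum (Suc m) k (complex_of_real (1 + x) \<cdot>\<^sub>m A) (1 \<cdot>\<^sub>m B)) =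
      complex_of_real ((1 + x) ^ (Suc m - k)) * mat_trace (word_sum (Suc m) k A B)" for x
    unfolding word_sum_smult[OF A B \<open>k \<le> Suc m\<close>] using A B by (subst trace_smult[where n = n]) auto
  moreover have "1 \<cdot>\<^sub>m A = A" "1 \<cdot>\<^sub>m B = B"
    by (auto intro!: eq_matI)
  moreover have "mat_trace (word_sum_pred m k A B * 0\<^sub>m n n) = 0"
    using A B by (subst right_mult_zero_mat[of _ n n]) (auto simp: mat_trace_def)
  ultimately have "((\<lambda>x. complex_of_real ((1 + x) ^ (Suc m - k)) * mat_trace (word_sum (Suc m) k A B))
    has_vector_derivative of_nat (Suc m) * mat_trace (word_sum m k A B * A)) (at 0)"
    by simp
  from has_vector_derivative_unique[OF this power_line_has_vector_derivative] show ?thesis .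
qed

text \<open>Euler's identity for the second matrix: differentiate \<open>Tr S(A, s B) = s ^ p Tr S(A, B)\<close> at \<open>s = 1\<close>, where \<open>p\<close> is the
  number of letters \<open>B\<close> in each word.\<close>

lemma euler_right:
  assumes A: "A \<in> carrier_mat n n" and B: "B \<in> carrier_mat n n" and "k \<le> m"
  shows "of_nat (Suc m) * mat_trace (word_sum m k A B * B)
    = of_nat (Suc k) * mat_trace (word_sum (Suc m) (Suc k) A B)"
proof -
  have le: "Suc k \<le> Suc m" using assms by simp
  have "((\<lambda>x. mat_trace (word_sum (Suc m) (Suc k) (1 \<cdot>\<^sub>m A) (complex_of_real (1 + x) \<cdot>\<^sub>m B))) has_vector_derivative
    of_nat (Suc m) * (mat_trace (word_sum m (Suc k) (1 \<cdot>\<^sub>m A) (complex_of_real (1 + 0) \<cdot>\<^sub>m B) * 0\<^sub>m n n)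
      + mat_trace (word_sum_pred m (Suc k) (1 \<cdot>\<^sub>m A) (complex_of_real (1 + 0) \<cdot>\<^sub>m B) * B))) (at 0)"
    using A B by (intro trace_word_sum_has_vector_derivative[where n = n] smult_line_has_vector_derivative) auto
  moreover have "mat_trace (word_sum (Suc m) (Suc k) (1 \<cdot>\<^sub>m A) (complex_of_real (1 + x) \<cdot>\<^sub>m B)) =
      complex_of_real ((1 + x) ^ Suc k) * mat_trace (word_sum (Suc m) (Suc k) A B)" for x
    unfolding word_sum_smult[OF A B le] using A B by (subst trace_smult[where n = n]) auto
  moreover have "1 \<cdot>\<^sub>m A = A" "1 \<cdot>\<^sub>m B = B"
    by (auto intro!: eq_matI)
  moreover have "mat_trace (word_sum m (Suc k) A B * 0\<^sub>m n n) = 0"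
    using A B by (subst right_mult_zero_mat[of _ n n]) (auto simp: mat_trace_def)
  ultimately have "((\<lambda>x. complex_of_real ((1 + x) ^ Suc k) * mat_trace (word_sum (Suc m) (Suc k) A B))
    has_vector_derivative of_nat (Suc m) * mat_trace (word_sum m k A B * B)) (at 0)"
    by (simp add: coeff_mat_pred_simps)
  from has_vector_derivative_unique[OF this power_line_has_vector_derivative] show ?thesis .
qed

section \<open>Minimizing over matrices of trace one\<close>

definition density_mat :: "nat \<Rightarrow> complex mat \<Rightarrow> bool"
  where "density_mat n A \<longleftrightarrow> form_nonneg n A \<and> mat_trace A = 1"

text \<open>Together with the bound of the diagonal by the trace this makes the set of density matrices
  bounded, and shows that a nonnegative form of trace zero vanishes.\<close>

lemma form_nonneg_entry_le:
  assumes A: "form_nonneg n A" and rs: "r < n" "s < n"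
  shows "2 * cmod (A $$ (r, s)) \<le> Re (A $$ (r, r)) + Re (A $$ (s, s))"
proof -
  \<comment> \<open>The form is evaluated at \<open>e\<^sub>s + w e\<^sub>r\<close>, with the phase \<open>w\<close> chosen to make the cross term \<open>- 2 cmod (A $$ (r, s))\<close>.\<close>
  define w where "w = (if A $$ (r, s) = 0 then 1 else - sgn (A $$ (r, s)))"
  have w: "cnj w * w = 1" "Re (cnj w * A $$ (r, s)) = - cmod (A $$ (r, s))"
  proof -
    have "cmod w = 1" by (simp add: w_def norm_sgn)
    then show "cnj w * w = 1" by (metis complex_norm_square mult.commute of_real_1 one_power2)
    have "cnj (sgn z) * z = of_real (cmod z)" for z
      by (cases "z = 0") (simp_all add: sgn_div_norm scaleR_conv_of_real field_simps
          complex_norm_square[symmetric] power2_eq_square mult.commute[of "cnj z"] flip: of_real_mult)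
    from this[of "A $$ (r, s)"] have "cnj w * A $$ (r, s) = - of_real (cmod (A $$ (r, s)))"
      unfolding w_def by (cases "A $$ (r, s) = 0") simp_all
    then show "Re (cnj w * A $$ (r, s)) = - cmod (A $$ (r, s))"
      by (metis Re_complex_of_real uminus_complex.sel(1))
  qed
  define x where "x = (\<lambda>i. if i = s then 1 else 0 :: complex)"
  define u where "u = (\<lambda>i. if i = r then w else 0 :: complex)"
  have x: "mat_app n A x i = A $$ (i, s)" for i
    using rs by (simp add: mat_app_def x_def if_distrib[of "\<lambda>c. _ * c"] cong: if_cong)
  have u: "mat_app n A u i = A $$ (i, r) * w" for i
    using rs by (simp add: mat_app_def u_def if_distrib[of "\<lambda>c. _ * c"] cong: if_cong)
  have "quad_form n A x = A $$ (s, s)"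
    unfolding quad_form_def x using rs
    by (simp add: x_def if_distrib[of cnj] if_distrib[of "\<lambda>c. c * _"] cong: if_cong)
  moreover have "(\<Sum>i<n. cnj (u i) * mat_app n A x i) = cnj w * A $$ (r, s)"
    unfolding x using rs by (simp add: u_def if_distrib[of cnj] if_distrib[of "\<lambda>c. c * _"] cong: if_cong)
  moreover have "quad_form n A u = cnj w * w * A $$ (r, r)"
  proof -
    have "quad_form n A u = (\<Sum>i<n. if i = r then cnj w * (A $$ (r, r) * w) else 0)"
      unfolding quad_form_def u by (intro sum.cong) (auto simp: u_def)
    then show ?thesis
      using rs by (simp add: mult_ac)
  qed
  moreover have "0 \<le> Re (quad_form n A (\<lambda>i. x i + of_real 1 * u i))"
    using A unfolding form_nonneg_def by blast
  ultimately show ?thesis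
    using A w by (simp only: form_nonneg_def quad_form_add) simp
qed

lemma form_nonneg_diag: "form_nonneg n A \<Longrightarrow> r < n \<Longrightarrow> 0 \<le> Re (A $$ (r, r))"
  using form_nonneg_entry_le[of n A r r] by (smt (verit) norm_ge_zero)

lemma form_nonneg_trace: 
  assumes "form_nonneg n A"
  shows "Re (mat_trace A) = (\<Sum>i<n. Re (A $$ (i, i)))" "0 \<le> Re (mat_trace A)"
proof -
  show *: "Re (mat_trace A) = (\<Sum>i<n. Re (A $$ (i, i)))"
    using assms by (simp add: trace_eq_sum[OF form_nonneg_carrier])
  show "0 \<le> Re (mat_trace A)"
    unfolding * using assms by (intro sum_nonneg form_nonneg_diag) auto
qed

lemma form_nonneg_diag_le_trace:
  assumes "form_nonneg n A" "r < n"
  shows "Re (A $$ (r, r)) \<le> Re (mat_trace A)"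
  unfolding form_nonneg_trace(1)[OF assms(1)]
  using assms by (intro member_le_sum) (auto intro: form_nonneg_diag)

lemma form_nonneg_entry_le_trace:
  assumes "form_nonneg n A" "r < n" "s < n"
  shows "cmod (A $$ (r, s)) \<le> Re (mat_trace A)"
  using form_nonneg_entry_le[OF assms] form_nonneg_diag_le_trace[OF assms(1,2)]
    form_nonneg_diag_le_trace[OF assms(1,3)] by simp

lemma density_mat_exists: "0 < n \<Longrightarrow> density_mat n (complex_of_real (1 / n) \<cdot>\<^sub>m 1\<^sub>m n)"
  using form_nonneg_smult[of n "1\<^sub>m n" "1 / n"]
  by (auto simp: density_mat_def form_nonneg_def hermitian_one quad_form_one sum_nonneg
      trace_smult[where n = n] trace_eq_sum[where n = n] simp del: of_real_power of_real_sum)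

lemma form_nonneg_normalize:
  assumes "0 < n" "form_nonneg n A"
  obtains A1 where "density_mat n A1" "A = complex_of_real (Re (mat_trace A)) \<cdot>\<^sub>m A1"
proof (cases "Re (mat_trace A) = 0")
  case True
  then have "A = complex_of_real (Re (mat_trace A)) \<cdot>\<^sub>m (complex_of_real (1 / n) \<cdot>\<^sub>m 1\<^sub>m n)"
    using form_nonneg_entry_le_trace[OF assms(2)] form_nonneg_carrier[OF assms(2)]
    by (intro eq_matI) auto
  then show ?thesis
    using density_mat_exists[OF assms(1)] that by blast
next
  case False
  define a where "a = Re (mat_trace A)"
  have a: "a > 0" "mat_trace A = of_real a"
    using False form_nonneg_trace(2)[OF assms(2)] hermitian_trace_real assms(2)
    by (auto simp: a_def form_nonneg_def)
  have "density_mat n (complex_of_real (1 / a) \<cdot>\<^sub>m A)"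
    using assms(2) a unfolding density_mat_def
    by (simp add: form_nonneg_smult trace_smult[OF form_nonneg_carrier] del: of_real_divide)
      (simp add: field_simps)
  moreover have "A = complex_of_real a \<cdot>\<^sub>m (complex_of_real (1 / a) \<cdot>\<^sub>m A)"
    using a by (simp add: smult_smult_mat) (auto intro!: eq_matI)
  ultimately show ?thesis
    using that by (simp add: a_def)
qed

text \<open>Coordinates outside the matrix are only required to be bounded, so that the set is cut out
  of a product of disks.\<close>

definition density_families :: "nat \<Rightarrow> (nat \<times> nat \<Rightarrow> complex) set"
  where "density_families n = {x. (\<forall>p. cmod (x p) \<le> 1) \<and> density_mat n (mat n n x)}"

lemma compact_density_families: "compact (density_families n)"
proof -
  have q: "quad_form n (mat n n x) z = (\<Sum>i<n. cnj (z i) * (\<Sum>j<n. x (i, j) * z j))" for x z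
    by (simp add: quad_form_def mat_app_def)
  have h: "hermitian_mat n (mat n n x) \<longleftrightarrow> (\<forall>i. \<forall>j. i < n \<and> j < n \<longrightarrow> cnj (x (i, j)) = x (j, i))" for x
    using hermitian_entry[of n "mat n n x"] hermitianI[of "mat n n x" n] by fastforce
  have t: "mat_trace (mat n n x) = (\<Sum>i<n. x (i, i))" for x :: "nat \<times> nat \<Rightarrow> complex"
    by (simp add: mat_trace_def)
  note cont = continuous_on_Re continuous_on_sum continuous_on_mult continuous_on_cnj
    continuous_on_const continuous_on_entry
  have "closed {x :: nat \<times> nat \<Rightarrow> complex. hermitian_mat n (mat n n x)}"
    unfolding h by (intro closed_Collect_all closed_Collect_imp closed_Collect_eq cont) simp
  moreover have "closed {x :: nat \<times> nat \<Rightarrow> complex. \<forall>z. 0 \<le> Re (quad_form n (mat n n x) z)}"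
    unfolding q by (intro closed_Collect_all closed_Collect_le cont)
  moreover have "closed {x :: nat \<times> nat \<Rightarrow> complex. mat_trace (mat n n x) = 1}"
    unfolding t by (intro closed_Collect_eq cont)
  ultimately have "closed ({x :: nat \<times> nat \<Rightarrow> complex. hermitian_mat n (mat n n x)} \<inter>
      {x. \<forall>z. 0 \<le> Re (quad_form n (mat n n x) z)} \<inter> {x. mat_trace (mat n n x) = 1})"
    by (intro closed_Int)
  from compact_Int_closed[OF compact_bounded_families this] show ?thesis
    by (simp add: density_families_def density_mat_def form_nonneg_def Int_def conj_assoc)
qed

lemma density_family_exists:
  assumes "density_mat n A"
  obtains x where "x \<in> density_families n" "mat n n x = A"
proof
  let ?x = "\<lambda>(i, j). if i < n \<and> j < n then A $$ (i, j) else 0"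
  show eq: "mat n n ?x = A"
    using assms form_nonneg_carrier[of n A] by (intro eq_matI) (auto simp: density_mat_def)
  show "?x \<in> density_families n"
    using assms form_nonneg_entry_le_trace[of n A] by (auto simp: density_families_def eq density_mat_def)
qed

lemma minimizing_density_mats:
  assumes "0 < n"
  obtains A B where "density_mat n A" "density_mat n B"
    "\<And>A' B'. density_mat n A' \<Longrightarrow> density_mat n B' \<Longrightarrow>
      Re (mat_trace (word_sum m k A B)) \<le> Re (mat_trace (word_sum m k A' B'))"
proof -
  define K where "K = density_families n \<times> density_families n"
  define f where "f = (\<lambda>p. Re (mat_trace (word_sum m k (mat n n (fst p)) (mat n n (snd p)))))"
  obtain x where "x \<in> density_families n"
    using density_family_exists[OF density_mat_exists[OF assms]] by metis
  then have "(x, x) \<in> K"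
    by (simp add: K_def)
  then have "K \<noteq> {}"
    by (metis empty_iff)
  moreover have "compact K"
    unfolding K_def by (intro compact_Times compact_density_families)
  moreover have "continuous_on K f"
  proof -
    have 1: "continuous_on K (\<lambda>p. fst p q)" "continuous_on K (\<lambda>p. snd p q)" for q
      by (rule continuous_on_product_then_coordinatewise, intro continuous_on_fst continuous_on_snd continuous_on_id)+
    have "continuous_on K (\<lambda>p. \<Sum>i<n. word_sum m k (mat n n (fst p)) (mat n n (snd p)) $$ (i, i))"
      by (intro continuous_on_sum continuous_on_word_sum[where n = n]) (auto simp: 1)
    then show ?thesis
      unfolding f_def by (simp add: trace_eq_sum[where n = n] continuous_on_Re del: Re_sum)
  qed
  ultimately have "\<exists>p\<in>K. \<forall>q\<in>K. f p \<le> f q"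
    by (intro continuous_attains_inf)
  then obtain p where p: "p \<in> K" "\<And>q. q \<in> K \<Longrightarrow> f p \<le> f q" by metis
  show ?thesis
  proof
    show "density_mat n (mat n n (fst p))" "density_mat n (mat n n (snd p))"
      using p(1) by (auto simp: K_def density_families_def)
    fix A' B' assume "density_mat n A'" "density_mat n B'"
    then obtain x y where "x \<in> density_families n" "mat n n x = A'" "y \<in> density_families n" "mat n n y = B'"
      by (meson density_family_exists)
    then show "Re (mat_trace (word_sum m k (mat n n (fst p)) (mat n n (snd p)))) \<le> Re (mat_trace (word_sum m k A' B'))"
      using p(2)[of "(x, y)"] by (auto simp: K_def f_def)
  qed
qed

text \<open>The bound on matrices of trace one extends to all nonnegative forms by scaling. A matrix of
  trace zero is the multiple by \<open>0\<close> of any matrix of trace one and needs no separate treatment.\<close>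

lemma homogeneous_lower_bound:
  assumes "0 < n" "k \<le> m"
    and min: "\<And>A' B'. density_mat n A' \<Longrightarrow> density_mat n B' \<Longrightarrow> c \<le> Re (mat_trace (word_sum m k A' B'))"
    and A: "form_nonneg n A" and B: "form_nonneg n B"
  shows "c * Re (mat_trace A) ^ (m - k) * Re (mat_trace B) ^ k \<le> Re (mat_trace (word_sum m k A B))"
proof -
  define a b where "a = Re (mat_trace A)" and "b = Re (mat_trace B)"
  obtain A1 where A1: "density_mat n A1" "A = complex_of_real a \<cdot>\<^sub>m A1"
    using form_nonneg_normalize[OF \<open>0 < n\<close> A] by (auto simp: a_def)
  obtain B1 where B1: "density_mat n B1" "B = complex_of_real b \<cdot>\<^sub>m B1"
    using form_nonneg_normalize[OF \<open>0 < n\<close> B] by (auto simp: b_def)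
  have car: "A1 \<in> carrier_mat n n" "B1 \<in> carrier_mat n n"
    using A1 B1 form_nonneg_carrier by (auto simp: density_mat_def)
  have "mat_trace (word_sum m k A B) = of_real (a ^ (m - k) * b ^ k) * mat_trace (word_sum m k A1 B1)"
    unfolding A1(2) B1(2) word_sum_smult[OF car \<open>k \<le> m\<close>] using car
    by (subst trace_smult[where n = n]) auto
  then have "Re (mat_trace (word_sum m k A B)) = (a ^ (m - k) * b ^ k) * Re (mat_trace (word_sum m k A1 B1))"
    by (simp del: of_real_mult of_real_power)
  moreover have "0 \<le> a ^ (m - k) * b ^ k"
    using form_nonneg_trace(2)[OF A] form_nonneg_trace(2)[OF B] by (simp add: a_def b_def)
  ultimately show ?thesis
    using mult_left_mono[OF min[OF A1(1) B1(1)], of "a ^ (m - k) * b ^ k"] by (simp add: a_def b_def mult_ac)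
qed

section \<open>Stationarity and the descent step\<close>

lemma congruence_line:
  fixes X A :: "complex mat"
  assumes X: "X \<in> carrier_mat n n" and A: "A \<in> carrier_mat n n"
  shows "(1\<^sub>m n + of_real e \<cdot>\<^sub>m X) * A * mat_adjoint (1\<^sub>m n + of_real e \<cdot>\<^sub>m X)
    = A + of_real e \<cdot>\<^sub>m (X * A + A * mat_adjoint X) + of_real (e\<^sup>2) \<cdot>\<^sub>m (X * A * mat_adjoint X)"
proof -
  define Y where "Y = mat_adjoint X"
  have Y: "Y \<in> carrier_mat n n" using X by (simp add: Y_def)
  have adj: "mat_adjoint (1\<^sub>m n + of_real e \<cdot>\<^sub>m X) = 1\<^sub>m n + of_real e \<cdot>\<^sub>m Y"
    using X by (intro eq_matI) (auto simp: adjoint_entry[where n = n] Y_def)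
  have "(1\<^sub>m n + of_real e \<cdot>\<^sub>m X) * A = 1\<^sub>m n * A + of_real e \<cdot>\<^sub>m X * A"
    using X A by (intro add_mult_distrib_mat[of _ n n]) auto
  also have "\<dots> = A + of_real e \<cdot>\<^sub>m (X * A)"
    using X A by (simp add: mult_smult_assoc_mat[of _ n n _ n])
  finally have 1: "(1\<^sub>m n + of_real e \<cdot>\<^sub>m X) * A = A + of_real e \<cdot>\<^sub>m (X * A)" .
  have expand: "Z * (1\<^sub>m n + of_real e \<cdot>\<^sub>m Y) = Z + of_real e \<cdot>\<^sub>m (Z * Y)" if Z: "Z \<in> carrier_mat n n" for Z
  proof -
    have "Z * (1\<^sub>m n + of_real e \<cdot>\<^sub>m Y) = Z * 1\<^sub>m n + Z * (of_real e \<cdot>\<^sub>m Y)"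
      using Z Y by (intro mult_add_distrib_mat[of _ n n]) auto
    then show ?thesis
      using Z Y by (simp add: mult_smult_distrib[of _ n n _ n])
  qed
  have "(A + of_real e \<cdot>\<^sub>m (X * A)) * Y = A * Y + of_real e \<cdot>\<^sub>m (X * A * Y)"
    using X A Y by (simp add: add_mult_distrib_mat[of _ n n] mult_smult_assoc_mat[of _ n n _ n])
  then have "(1\<^sub>m n + of_real e \<cdot>\<^sub>m X) * A * (1\<^sub>m n + of_real e \<cdot>\<^sub>m Y)
      = A + of_real e \<cdot>\<^sub>m (X * A) + of_real e \<cdot>\<^sub>m (A * Y + of_real e \<cdot>\<^sub>m (X * A * Y))"
    unfolding 1 using X A Y by (subst expand) auto
  also have "\<dots> = A + of_real e \<cdot>\<^sub>m (X * A + A * Y) + of_real (e\<^sup>2) \<cdot>\<^sub>m (X * A * Y)"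
  proof -
    define P Q R where "P = X * A" and "Q = A * Y" and "R = X * A * Y"
    have "P \<in> carrier_mat n n" "Q \<in> carrier_mat n n" "R \<in> carrier_mat n n"
      using X A Y by (auto simp: P_def Q_def R_def)
    then have "A + of_real e \<cdot>\<^sub>m P + of_real e \<cdot>\<^sub>m (Q + of_real e \<cdot>\<^sub>m R)
        = A + of_real e \<cdot>\<^sub>m (P + Q) + of_real (e\<^sup>2) \<cdot>\<^sub>m R"
      using A by (intro eq_matI) (auto simp: algebra_simps power2_eq_square)
    then show ?thesis by (simp only: P_def Q_def R_def)
  qed
  finally show ?thesis
    unfolding adj Y_def .
qed

text \<open>These curves of nonnegative forms through \<open>A\<close> have the tangent \<open>X A + A X\<^sup>*\<close> at \<open>A\<close>. They can be
  followed in both directions of \<open>e\<close>, even when \<open>A\<close> is on the boundary of the cone.\<close>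

lemma form_nonneg_line:
  assumes "form_nonneg n A" and X: "X \<in> carrier_mat n n"
  shows "form_nonneg n (A + of_real e \<cdot>\<^sub>m (X * A + A * mat_adjoint X) + of_real (e\<^sup>2) \<cdot>\<^sub>m (X * A * mat_adjoint X))"
  unfolding congruence_line[OF X form_nonneg_carrier[OF assms(1)], symmetric]
  using assms by (intro form_nonneg_congruence) auto

lemma line_entry:
  fixes A :: "'a :: comm_ring_1 mat"
  shows "A \<in> carrier_mat n n \<Longrightarrow> H \<in> carrier_mat n n \<Longrightarrow> G \<in> carrier_mat n n \<Longrightarrow> i < n \<Longrightarrow> j < n \<Longrightarrow>
    (A + a \<cdot>\<^sub>m H + b \<cdot>\<^sub>m G) $$ (i, j) = A $$ (i, j) + a * H $$ (i, j) + b * G $$ (i, j)"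
  by simp

lemma line_at_zero:
  fixes A :: "'a :: comm_ring_1 mat"
  shows "A \<in> carrier_mat n n \<Longrightarrow> H \<in> carrier_mat n n \<Longrightarrow> G \<in> carrier_mat n n \<Longrightarrow> A + 0 \<cdot>\<^sub>m H + 0 \<cdot>\<^sub>m G = A"
  by (rule eq_matI) auto

text \<open>For \<open>X = U A\<close> the pairing of \<open>U\<close> with the tangent \<open>X A + A X\<^sup>*\<close> is a sum of squares.\<close>

lemma trace_mult_tangent:
  assumes U: "hermitian_mat n U" and A: "hermitian_mat n A"
  defines "X \<equiv> U * A"
  shows "mat_trace (U * (X * A + A * mat_adjoint X)) = 2 * mat_trace (X * mat_adjoint X)"
proof -
  note [simp] = hermitian_carrier[OF U] hermitian_carrier[OF A]
  have adj: "mat_adjoint X = A * U"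
    using U A by (simp add: X_def adjoint_mult[where n = n] hermitian_mat_def)
  have "mat_trace (U * (X * A + A * (A * U))) = mat_trace (U * (X * A)) + mat_trace (U * (A * (A * U)))"
    by (simp add: X_def square_distrib[where n = n] trace_add[where n = n])
  also have "U * (A * (A * U)) = X * (A * U)"
    unfolding X_def by (rule assoc_mult_mat[of _ n n _ n _ n, symmetric]) auto
  also have "mat_trace (U * (X * A)) = mat_trace (X * A * U)"
    by (rule trace_mult_commute[of _ n]) (auto simp: X_def)
  also have "X * A * U = X * (A * U)"
    by (rule assoc_mult_mat[of _ n n _ n _ n]) (auto simp: X_def)
  finally show ?thesis
    by (simp add: adj)
qed

lemma quadratic_line_has_vector_derivative:
  "((\<lambda>e. a + complex_of_real e * b + complex_of_real (e\<^sup>2) * c) has_vector_derivative b) (at 0)"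
proof -
  have "((\<lambda>e. complex_of_real e) has_vector_derivative 1) (at 0)"
    using bounded_linear.has_vector_derivative[OF bounded_linear_of_real has_vector_derivative_id[of "at 0"]]
    by simp
  then show ?thesis
    unfolding of_real_power power2_eq_square by (auto intro!: derivative_eq_intros)
qed

lemma monomial_derivative_at_one:
  fixes f g :: "real \<Rightarrow> real"
  assumes "(f has_real_derivative f') (at x)" "(g has_real_derivative g') (at x)" "f x = 1" "g x = 1"
  shows "((\<lambda>t. c * f t ^ p * g t ^ q) has_real_derivative c * (p * f' + q * g')) (at x)"
  using assms by (auto intro!: derivative_eq_intros simp: algebra_simps)

lemma shift_mult:
  fixes W :: "complex mat"
  assumes "W \<in> carrier_mat n n" "H \<in> carrier_mat n n"
  shows "(a \<cdot>\<^sub>m W + b \<cdot>\<^sub>m 1\<^sub>m n) * H = a \<cdot>\<^sub>m (W * H) + b \<cdot>\<^sub>m H"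
  using assms by (simp add: square_distrib[where n = n] square_smult[where n = n])

text \<open>\<open>U\<close> and \<open>V\<close> are the gradients in \<open>A\<close> and \<open>B\<close> of the difference between the trace of the word sum and
  its lower bound. Moving along the curves with \<open>X = U A\<close> and \<open>Y = V B\<close> simultaneously, the
  derivative of that difference is \<open>2 Tr X X\<^sup>* + 2 Tr Y Y\<^sup>*\<close>, and it is zero at a minimum.\<close>

lemma stationary:
  assumes A: "density_mat n A" and B: "density_mat n B" and k: "k \<le> Suc m"
    and bound: "\<And>A' B'. form_nonneg n A' \<Longrightarrow> form_nonneg n B' \<Longrightarrow>
      c * Re (mat_trace A') ^ (Suc m - k) * Re (mat_trace B') ^ k \<le> Re (mat_trace (word_sum (Suc m) k A' B'))"
    and attained: "Re (mat_trace (word_sum (Suc m) k A B)) = c"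
  defines "U \<equiv> complex_of_real (Suc m) \<cdot>\<^sub>m word_sum m k A B + complex_of_real (- c * (Suc m - k)) \<cdot>\<^sub>m 1\<^sub>m n"
    and "V \<equiv> complex_of_real (Suc m) \<cdot>\<^sub>m word_sum_pred m k A B + complex_of_real (- c * k) \<cdot>\<^sub>m 1\<^sub>m n"
  shows "U * A = 0\<^sub>m n n" "V * B = 0\<^sub>m n n"
proof -
  have herm: "hermitian_mat n A" "hermitian_mat n B" and psd: "form_nonneg n A" "form_nonneg n B"
    and tr: "mat_trace A = 1" "mat_trace B = 1"
    using A B by (auto simp: density_mat_def form_nonneg_def)
  note [simp] = herm[THEN hermitian_carrier]
  have "hermitian_mat n (word_sum_pred m k A B)"
    by (cases k) (auto simp: coeff_mat_pred_simps(1)[where n = n] coeff_mat_pred_simps(2)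
        intro!: hermitian_word_sum herm hermitianI[of "0\<^sub>m n n"])
  then have UV: "hermitian_mat n U" "hermitian_mat n V"
    unfolding U_def V_def by (intro hermitian_add hermitian_smult hermitian_word_sum hermitian_one herm; simp)+
  note [simp] = UV[THEN hermitian_carrier]
  define X Y where "X = U * A" and "Y = V * B"
  have [simp]: "X \<in> carrier_mat n n" "Y \<in> carrier_mat n n"
    by (auto simp: X_def Y_def)
  define H where "H = X * A + A * mat_adjoint X"
  define K where "K = Y * B + B * mat_adjoint Y"
  have [simp]: "H \<in> carrier_mat n n" "K \<in> carrier_mat n n"
    by (auto simp: H_def K_def)
  define Ae where "Ae = (\<lambda>e. A + of_real e \<cdot>\<^sub>m H + of_real (e\<^sup>2) \<cdot>\<^sub>m (X * A * mat_adjoint X))"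
  define Be where "Be = (\<lambda>e. B + of_real e \<cdot>\<^sub>m K + of_real (e\<^sup>2) \<cdot>\<^sub>m (Y * B * mat_adjoint Y))"
  have carrier [simp]: "Ae e \<in> carrier_mat n n" "Be e \<in> carrier_mat n n" for e
    by (auto simp: Ae_def Be_def)
  have psd_e: "form_nonneg n (Ae e)" "form_nonneg n (Be e)" for e
    unfolding Ae_def Be_def H_def K_def by (intro form_nonneg_line psd; simp)+
  have zero [simp]: "Ae 0 = A" "Be 0 = B"
    using line_at_zero[of A n H "X * A * mat_adjoint X"] line_at_zero[of B n K "Y * B * mat_adjoint Y"]
    by (simp_all add: Ae_def Be_def)
  have dA: "((\<lambda>e. Ae e $$ (i, j)) has_vector_derivative H $$ (i, j)) (at 0)" if "i < n" "j < n" for i j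
  proof -
    have "Ae e $$ (i, j) = A $$ (i, j) + of_real e * H $$ (i, j)
        + of_real (e\<^sup>2) * (X * A * mat_adjoint X) $$ (i, j)" for e
      unfolding Ae_def using that by (intro line_entry) auto
    then show ?thesis by (simp only: quadratic_line_has_vector_derivative)
  qed
  have dB: "((\<lambda>e. Be e $$ (i, j)) has_vector_derivative K $$ (i, j)) (at 0)" if "i < n" "j < n" for i j
  proof -
    have "Be e $$ (i, j) = B $$ (i, j) + of_real e * K $$ (i, j)
        + of_real (e\<^sup>2) * (Y * B * mat_adjoint Y) $$ (i, j)" for e
      unfolding Be_def using that by (intro line_entry) auto
    then show ?thesis by (simp only: quadratic_line_has_vector_derivative)
  qed
  \<comment> \<open>The two sides of the bound are differentiated along the curves.\<close>
  have trace_deriv: "((\<lambda>e. Re (mat_trace (F e))) has_real_derivative Re (mat_trace D)) (at 0)"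
    if "\<And>e. F e \<in> carrier_mat n n" "D \<in> carrier_mat n n"
      "\<And>i j. i < n \<Longrightarrow> j < n \<Longrightarrow> ((\<lambda>e. F e $$ (i, j)) has_vector_derivative D $$ (i, j)) (at 0)" for F D
  proof -
    have "((\<lambda>e. \<Sum>i<n. F e $$ (i, i)) has_vector_derivative (\<Sum>i<n. D $$ (i, i))) (at 0)"
      by (intro has_vector_derivative_sum that(3)) auto
    from bounded_linear.has_vector_derivative[OF bounded_linear_Re this] show ?thesis
      using that(1,2) by (simp add: trace_eq_sum[where n = n] has_real_derivative_iff_has_vector_derivative)
  qed
  define W where "W = mat_trace (word_sum m k A B * H) + mat_trace (word_sum_pred m k A B * K)"
  have "((\<lambda>e. mat_trace (word_sum (Suc m) k (Ae e) (Be e))) has_vector_derivative of_nat (Suc m) * W) (at 0)"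
    using trace_word_sum_has_vector_derivative[of Ae n H Be K k m] dA dB by (simp add: W_def)
  from bounded_linear.has_vector_derivative[OF bounded_linear_Re this]
  have "((\<lambda>e. Re (mat_trace (word_sum (Suc m) k (Ae e) (Be e)))) has_real_derivative real (Suc m) * Re W) (at 0)"
    by (simp add: has_real_derivative_iff_has_vector_derivative del: of_nat_Suc)
  moreover have "((\<lambda>e. c * Re (mat_trace (Ae e)) ^ (Suc m - k) * Re (mat_trace (Be e)) ^ k) has_real_derivative
      c * (real (Suc m - k) * Re (mat_trace H) + real k * Re (mat_trace K))) (at 0)"
    by (intro monomial_derivative_at_one trace_deriv dA dB) (auto simp: tr)
  ultimately have "((\<lambda>e. Re (mat_trace (word_sum (Suc m) k (Ae e) (Be e)))
        - c * Re (mat_trace (Ae e)) ^ (Suc m - k) * Re (mat_trace (Be e)) ^ k) has_real_derivative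
      real (Suc m) * Re W - c * (real (Suc m - k) * Re (mat_trace H) + real k * Re (mat_trace K))) (at 0)"
    by (rule DERIV_diff)
  then have "real (Suc m) * Re W - c * (real (Suc m - k) * Re (mat_trace H) + real k * Re (mat_trace K)) = 0"
    by (rule DERIV_local_min[of _ _ _ 1]) (use bound[OF psd_e] attained tr in auto)
  moreover have "Re (mat_trace (U * H)) = real (Suc m) * Re (mat_trace (word_sum m k A B * H))
      - c * real (Suc m - k) * Re (mat_trace H)"
    unfolding U_def
    by (simp add: shift_mult[where n = n] trace_add[where n = n] trace_smult[where n = n]
        del: of_nat_Suc of_real_mult of_real_minus)
  moreover have "Re (mat_trace (V * K)) = real (Suc m) * Re (mat_trace (word_sum_pred m k A B * K))
      - c * real k * Re (mat_trace K)"
    unfolding V_def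
    by (simp add: shift_mult[where n = n] trace_add[where n = n] trace_smult[where n = n]
        del: of_nat_Suc of_real_mult of_real_minus)
  ultimately have "Re (mat_trace (U * H)) + Re (mat_trace (V * K)) = 0"
    by (simp add: W_def algebra_simps)
  moreover have "mat_trace (U * H) = 2 * mat_trace (X * mat_adjoint X)"
    unfolding H_def X_def by (rule trace_mult_tangent[OF UV(1) herm(1)])
  moreover have "mat_trace (V * K) = 2 * mat_trace (Y * mat_adjoint Y)"
    unfolding K_def Y_def by (rule trace_mult_tangent[OF UV(2) herm(2)])
  ultimately have "Re (mat_trace (X * mat_adjoint X)) + Re (mat_trace (Y * mat_adjoint Y)) = 0"
    by simp
  then have "Re (mat_trace (X * mat_adjoint X)) \<le> 0" "Re (mat_trace (Y * mat_adjoint Y)) \<le> 0"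
    using trace_mult_adjoint_nonneg[of X n] trace_mult_adjoint_nonneg[of Y n] by auto
  then show "U * A = 0\<^sub>m n n" "V * B = 0\<^sub>m n n"
    using zero_if_trace_mult_adjoint_le_zero[of X n] zero_if_trace_mult_adjoint_le_zero[of Y n]
    by (auto simp: X_def Y_def)
qed

text \<open>The two stationarity equations add up, because the words of length \<open>m + 1\<close> are those of
  length \<open>m\<close> followed by \<open>A\<close> or by \<open>B\<close>.\<close>

lemma word_sum_at_minimum:
  assumes A: "density_mat n A" and B: "density_mat n B" and k: "k \<le> Suc m"
    and bound: "\<And>A' B'. form_nonneg n A' \<Longrightarrow> form_nonneg n B' \<Longrightarrow>
      c * Re (mat_trace A') ^ (Suc m - k) * Re (mat_trace B') ^ k \<le> Re (mat_trace (word_sum (Suc m) k A' B'))"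
    and attained: "Re (mat_trace (word_sum (Suc m) k A B)) = c"
  shows "complex_of_real (Suc m) \<cdot>\<^sub>m word_sum (Suc m) k A B =
    complex_of_real c \<cdot>\<^sub>m (complex_of_real (Suc m - k) \<cdot>\<^sub>m A + complex_of_real k \<cdot>\<^sub>m B)"
proof -
  have AB: "A \<in> carrier_mat n n" "B \<in> carrier_mat n n"
    using A B form_nonneg_carrier by (auto simp: density_mat_def)
  define P Q where "P = word_sum m k A B * A" and "Q = word_sum_pred m k A B * B"
  have PQ: "P \<in> carrier_mat n n" "Q \<in> carrier_mat n n"
    using AB by (auto simp: P_def Q_def)
  note [simp] = AB PQ AB[THEN carrier_matD(1)] AB[THEN carrier_matD(2)] PQ[THEN carrier_matD(1)] PQ[THEN carrier_matD(2)]
  have P: "complex_of_real (Suc m) \<cdot>\<^sub>m P + complex_of_real (- c * (Suc m - k)) \<cdot>\<^sub>m A = 0\<^sub>m n n"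
    using stationary(1)[OF assms] unfolding P_def
    by (simp add: shift_mult[where n = n] del: of_nat_Suc of_real_mult of_real_minus)
  have 1: "complex_of_real (Suc m) * P $$ (i, j) = complex_of_real (c * (Suc m - k)) * A $$ (i, j)"
    if "i < n" "j < n" for i j
    using that arg_cong[OF P, of "\<lambda>M. M $$ (i, j)"] by simp
  have Q: "complex_of_real (Suc m) \<cdot>\<^sub>m Q + complex_of_real (- c * k) \<cdot>\<^sub>m B = 0\<^sub>m n n"
    using stationary(2)[OF assms] unfolding Q_def
    by (simp add: shift_mult[where n = n] del: of_nat_Suc of_real_mult of_real_minus)
  have 2: "complex_of_real (Suc m) * Q $$ (i, j) = complex_of_real (c * k) * B $$ (i, j)"
    if "i < n" "j < n" for i j
    using that arg_cong[OF Q, of "\<lambda>M. M $$ (i, j)"] by simp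
  have "word_sum (Suc m) k A B = P + Q"
    unfolding P_def Q_def by (rule word_sum_Suc[of _ n]) auto
  then show ?thesis
    using 1 2 by (intro eq_matI) (auto simp: distrib_left mult.assoc)
qed

text \<open>At a negative minimum the word sum \<open>S\<close> is a negative multiple of the Hermitian matrix
  \<open>C = (m - k) A + k B\<close>. The hypothesis for words of length \<open>m + 1\<close> makes the traces of \<open>S A\<close> and \<open>S B\<close>
  nonnegative, hence also that of \<open>S C\<close>, so the trace of \<open>C C\<close> is at most zero. This forces \<open>C = 0\<close>,
  although the trace of \<open>C\<close> is \<open>m\<close>.\<close>

lemma BMV_if_BMV_Suc:
  assumes BMV: "BMV (Suc m)" and "0 < m"
  shows "BMV m"
  unfolding BMV_def
proof (intro allI impI)
  fix n :: nat and A B :: "complex mat" and k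
  assume n: "0 < n" and psd: "psd_mat n A" "psd_mat n B"
  have forms: "form_nonneg n A" "form_nonneg n B"
    using psd n by (auto intro: form_nonneg_if_psd)
  then have herm: "hermitian_mat n A" "hermitian_mat n B"
    by (auto simp: form_nonneg_def)
  note car = herm[THEN hermitian_carrier]
  show "coeff (bmv_poly m A B) k \<in> \<real>\<^sub>\<ge>\<^sub>0"
  proof (cases "k \<le> m")
    case False
    then show ?thesis
      using car by (simp add: coeff_bmv_poly[OF car] word_sum_eq_zero[where n = n] mat_trace_def)
  next
    case k: True
    obtain m' where m': "m = Suc m'" using \<open>0 < m\<close> by (cases m) auto
    obtain A0 B0 where AB: "density_mat n A0" "density_mat n B0"
      and min: "\<And>A' B'. density_mat n A' \<Longrightarrow> density_mat n B' \<Longrightarrow>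
        Re (mat_trace (word_sum m k A0 B0)) \<le> Re (mat_trace (word_sum m k A' B'))"
      using minimizing_density_mats[OF n, where m = m and k = k] by metis
    define c where "c = Re (mat_trace (word_sum m k A0 B0))"
    have bound: "c * Re (mat_trace A') ^ (m - k) * Re (mat_trace B') ^ k \<le> Re (mat_trace (word_sum m k A' B'))"
      if "form_nonneg n A'" "form_nonneg n B'" for A' B'
      using homogeneous_lower_bound[OF n k _ that] min unfolding c_def by blast
    have "0 \<le> c"
    proof (rule ccontr)
      assume "\<not> 0 \<le> c"
      then have c: "c < 0" by simp
      have psd0: "form_nonneg n A0" "form_nonneg n B0" and tr: "mat_trace A0 = 1" "mat_trace B0 = 1"
        using AB by (auto simp: density_mat_def)
      have herm0: "hermitian_mat n A0" "hermitian_mat n B0"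
        using psd0 by (auto simp: form_nonneg_def)
      note [simp] = herm0[THEN hermitian_carrier]
      define S where "S = word_sum m k A0 B0"
      define C where "C = complex_of_real (m - k) \<cdot>\<^sub>m A0 + complex_of_real k \<cdot>\<^sub>m B0"
      have [simp]: "S \<in> carrier_mat n n" "C \<in> carrier_mat n n"
        by (auto simp: S_def C_def)
      have S: "complex_of_real m \<cdot>\<^sub>m S = complex_of_real c \<cdot>\<^sub>m C"
        unfolding S_def C_def m'
      proof (rule word_sum_at_minimum[OF AB])
        show "k \<le> Suc m'" using k m' by simp
        show "c * Re (mat_trace A') ^ (Suc m' - k) * Re (mat_trace B') ^ k
            \<le> Re (mat_trace (word_sum (Suc m') k A' B'))"
          if "form_nonneg n A'" "form_nonneg n B'" for A' B'
          using bound[OF that] unfolding m' .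
        show "Re (mat_trace (word_sum (Suc m') k A0 B0)) = c"
          unfolding c_def m' ..
      qed
      have pos: "0 \<le> Re (mat_trace (word_sum (Suc m) j A0 B0))" for j
      proof -
        have "coeff (bmv_poly (Suc m) A0 B0) j \<in> \<real>\<^sub>\<ge>\<^sub>0"
          using BMV n psd0[THEN psd_if_form_nonneg] unfolding BMV_def by blast
        then show ?thesis
          by (simp add: coeff_bmv_poly[where n = n] complex_nonneg_Reals_iff)
      qed
      \<comment> \<open>This applies to \<open>D = A0\<close> and \<open>D = B0\<close>, where Euler's identities are the second premise.\<close>
      have nonpos: "Re (mat_trace (C * D)) \<le> 0"
        if "D \<in> carrier_mat n n" "of_nat (Suc m) * mat_trace (S * D) = of_nat p * mat_trace (word_sum (Suc m) j A0 B0)"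
        for D p j
      proof -
        have "real (Suc m) * Re (mat_trace (S * D)) = real p * Re (mat_trace (word_sum (Suc m) j A0 B0))"
          using arg_cong[OF that(2), of Re] by (simp del: of_nat_Suc)
        also have "0 \<le> \<dots>"
          using pos[of j] by simp
        finally have "0 \<le> Re (mat_trace (S * D))"
          by (simp add: zero_le_mult_iff)
        then have "0 \<le> real m * Re (mat_trace (S * D))"
          by simp
        also have "real m * Re (mat_trace (S * D)) = c * Re (mat_trace (C * D))"
        proof -
          have "of_real m * mat_trace (S * D) = of_real c * mat_trace (C * D)"
            using arg_cong[OF S, of "\<lambda>M. mat_trace (M * D)"] that(1)
            by (simp add: square_smult[where n = n] trace_smult[where n = n])
          from arg_cong[OF this, of Re] show ?thesis by simp
        qed
        finally show ?thesis
          using c by (simp add: zero_le_mult_iff)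
      qed
      have "Re (mat_trace (C * A0)) \<le> 0"
        by (rule nonpos[where j = k and p = "Suc m - k"]) (use euler_left[of A0 n B0 k m] k in \<open>auto simp: S_def\<close>)
      moreover have "Re (mat_trace (C * B0)) \<le> 0"
        by (rule nonpos[where j = "Suc k" and p = "Suc k"]) (use euler_right[of A0 n B0 k m] k in \<open>auto simp: S_def\<close>)
      moreover have "Re (mat_trace (C * C)) = real (m - k) * Re (mat_trace (C * A0)) + real k * Re (mat_trace (C * B0))"
      proof -
        have "C * C = of_real (m - k) \<cdot>\<^sub>m (C * A0) + of_real k \<cdot>\<^sub>m (C * B0)"
          by (subst (2) C_def) (simp add: square_distrib[where n = n] square_smult[where n = n])
        then show ?thesis
          by (simp add: trace_add[where n = n] trace_smult[where n = n])
      qed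
      moreover have "hermitian_mat n C"
        unfolding C_def by (intro hermitian_add hermitian_smult herm0)
      then have "mat_adjoint C = C"
        by (simp add: hermitian_mat_def)
      ultimately have "Re (mat_trace (C * mat_adjoint C)) \<le> 0"
        by (simp add: mult_nonneg_nonpos add_nonpos_nonpos)
      then have "C = 0\<^sub>m n n"
        by (intro zero_if_trace_mult_adjoint_le_zero) auto
      then have "mat_trace C = 0"
        by (simp add: mat_trace_def)
      moreover have "mat_trace C = of_nat m"
        using k by (simp add: C_def trace_add[where n = n] trace_smult[where n = n] tr flip: of_nat_add)
      ultimately show False
        using \<open>0 < m\<close> by simp
    qed
    then have "0 \<le> c * Re (mat_trace A) ^ (m - k) * Re (mat_trace B) ^ k"
      using forms by (simp add: form_nonneg_trace(2))
    then have "0 \<le> Re (mat_trace (word_sum m k A B))"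
      using bound[OF forms] by linarith
    moreover have "mat_trace (word_sum m k A B) = of_real (Re (mat_trace (word_sum m k A B)))"
      by (rule hermitian_trace_real[OF hermitian_word_sum[OF herm]])
    ultimately show ?thesis
      unfolding coeff_bmv_poly[OF car] by (metis nonneg_Reals_of_real_iff)
  qed
qed

theorem corollary1p8:
  fixes m0 :: nat
  assumes "0 < m0" and "BMV m0"
  shows "\<forall>m. 0 < m \<longrightarrow> m < m0 \<longrightarrow> BMV m"
proof (intro allI impI)
  fix m :: nat assume "0 < m" "m < m0"
  then have "m \<le> m0" by simp
  then show "BMV m"
    using \<open>0 < m\<close>
  proof (induction m rule: inc_induct)
    case base
    show ?case by (rule assms(2))
  next
    case (step i)
    show ?case
      by (rule BMV_if_BMV_Suc[OF step.IH[OF zero_less_Suc] step.prems])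
  qed
qed

end
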